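(* Let $p,n,q$ be positive integers, let $u=(u_1,\dots,u_n)$ be a family of vectors in $\mathbb Z^p$ with associated matrix $U\in\mathcal M_{p,n}(\mathbb Z)$ (whose columns are the $u_i$) and rank $r$, and let $k$ be a nonnegative even integer. Let $v=(v_1,\dots,v_n)$ be a family of $n$ vectors in $\mathbb Z^q$ with associated matrix $V\in\mathcal M_{q,n}(\mathbb Z)$ such that the rows of $V$ span the real vector space $\ker(U)\subset\mathbb R^n$. Then \[ \frac1{a^k}\,\mathrm{Sym}_k(u;x)=\frac1{b^k}\,\mathrm{Kir}_k(v;x), \] where $a:=\|\langle u\rangle_{\mathbb Z}\|/\|\mathrm{span}(u)\cap\mathbb Z^p\| = \bigl|(\mathrm{span}(u)\cap\mathbb Z^p)/\langle u\rangle_{\mathbb Z}\bigr|$ and $b:=\|\langle v\rangle_{\mathbb Z}\|/\|\mathrm{span}(v)\cap\mathbb Z^q\|=\bigl|(\mathrm{span}(v)\cap\mathbb Z^q)/\langle v\rangle_{\mathbb Z}\bigr|$.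
   Context: For a finite family $w=(w_1,\dots,w_m)$ of vectors in $\mathbb R^N$ with matrix $W$ (columns $w_i$), and $I=\{i_1<\dots<i_s\}\subset\{1,\dots,m\}$, $w_I=(w_{i_1},\dots,w_{i_s})$, $W_I$ is the corresponding matrix, and $\|\mathbf w_I\|:=\sqrt{\det(W_I^{\intercal}W_I)}$ (the norm of $w_{i_1}\wedge\dots\wedge w_{i_s}$ for the standard inner product on the exterior algebra). $\langle w\rangle_{\mathbb Z}$ is the $\mathbb Z$-module generated by $w$, $\mathrm{span}(w)$ the real span. For a submodule $A\subset\mathbb Z^N$ with basis $f$, $\|A\|:=\|\mathbf f\|$ (covolume; independent of the basis). Variables $x=(x_1,\dots,x_n)$, $x^I:=\prod_{i\in I}x_i$, $\overline I$ denotes the complement in $\{1,\dots,n\}$, and $a^0:=0$ if $a=0$ and $1$ otherwise. For a family $w$ of $n$ vectors in $\mathbb Z^N$ of rank $s$: $\mathrm{Kir}_k(w;x):=\|\mathrm{span}(w)\cap\mathbb Z^N\|^{-k}\sum_{I\subset\{1,\dots,n\},|I|=s}\|\mathbf w_I\|^k x^I$ and $\mathrm{Sym}_k(w;x):=\|\mathrm{span}(w)\cap\mathbb Z^N\|^{-k}\sum_{I\subset\{1,\dots,n\},|I|=s}\|\mathbf w_I\|^k x^{\overline I}$. *)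

theory Defs
  imports "Jordan_Normal_Form.DL_Rank" "Jordan_Normal_Form.Matrix_Kernel"
    "HOL-Algebra.AbelCoset" "HOL-Library.Poly_Mapping"
begin

(* A family w = (w_1, ..., w_m) of vectors in Z^N is a list of vectors of dimension N, the entries
   being numbered from 0.  The parameter N of the functions below is needed because it cannot be
   recovered from the empty family. *)

(* The convention of the source: a^0 = 0 if a = 0. *)
definition power0 :: "real \<Rightarrow> nat \<Rightarrow> real" where
  "power0 a k = (if a = 0 then 0 else a ^ k)"

(* The norm of the wedge product of w_1, ..., w_m in the exterior algebra, as a Gram determinant. *)
definition wedge_norm :: "nat \<Rightarrow> int vec list \<Rightarrow> real" where
  "wedge_norm N w =
     (let W = mat_of_cols N w in sqrt (real_of_int (det (transpose_mat W * W))))"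

definition int_span :: "nat \<Rightarrow> int vec list \<Rightarrow> int vec set" where
  "int_span N w = LinearCombinations.module.span class_ring (module_vec TYPE(int) N) (set w)"

definition real_span :: "nat \<Rightarrow> int vec list \<Rightarrow> real vec set" where
  "real_span N w =
     LinearCombinations.module.span class_ring (module_vec TYPE(real) N)
       (set (map (map_vec real_of_int) w))"

definition sat_span :: "nat \<Rightarrow> int vec list \<Rightarrow> int vec set" where
  "sat_span N w = {z \<in> carrier_vec N. map_vec real_of_int z \<in> real_span N w}"

definition family_rank :: "nat \<Rightarrow> int vec list \<Rightarrow> nat" where
  "family_rank N w = vec_space.rank N (map_mat real_of_int (mat_of_cols N w))"

definition is_int_basis :: "nat \<Rightarrow> int vec set \<Rightarrow> int vec list \<Rightarrow> bool" where
  "is_int_basis N A f \<longleftrightarrow>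
     set f \<subseteq> carrier_vec N \<and> distinct f \<and>
     \<not> LinearCombinations.module.lin_dep class_ring (module_vec TYPE(int) N) (set f) \<and>
     int_span N f = A"

(* The value does not depend on the basis that is chosen. *)
definition covol :: "nat \<Rightarrow> int vec set \<Rightarrow> real" where
  "covol N A = wedge_norm N (SOME f. is_int_basis N A f)"

(* |A / B| for subgroups B \<subseteq> A of Z^N *)
definition quotient_order :: "nat \<Rightarrow> int vec set \<Rightarrow> int vec set \<Rightarrow> nat" where
  "quotient_order N A B = Coset.order (((module_vec TYPE(int) N)\<lparr>carrier := A\<rparr>) A_Mod B)"

(* Polynomials in countably many indeterminates x_0, x_1, ... over the reals: finitely supported
   functions from exponent vectors to coefficients, with the convolution product. *)
type_synonym real_mpoly = "(nat \<Rightarrow>\<^sub>0 nat) \<Rightarrow>\<^sub>0 real"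

definition mconst :: "real \<Rightarrow> real_mpoly" where
  "mconst c = Poly_Mapping.single 0 c"

definition mvar :: "nat \<Rightarrow> real_mpoly" where
  "mvar i = Poly_Mapping.single (Poly_Mapping.single i 1) 1"

definition mprod :: "nat set \<Rightarrow> real_mpoly" where
  "mprod I = (\<Prod>i\<in>I. mvar i)"

(* nths w I is the subfamily w_I, listed in increasing order of indices. *)
definition Kir :: "nat \<Rightarrow> nat \<Rightarrow> int vec list \<Rightarrow> real_mpoly" where
  "Kir N k w =
     mconst (1 / power0 (covol N (sat_span N w)) k) *
     (\<Sum>I | I \<subseteq> {..<length w} \<and> card I = family_rank N w.
        mconst (power0 (wedge_norm N (nths w I)) k) * mprod I)"

definition Sym :: "nat \<Rightarrow> nat \<Rightarrow> int vec list \<Rightarrow> real_mpoly" where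
  "Sym N k w =
     mconst (1 / power0 (covol N (sat_span N w)) k) *
     (\<Sum>I | I \<subseteq> {..<length w} \<and> card I = family_rank N w.
        mconst (power0 (wedge_norm N (nths w I)) k) * mprod ({..<length w} - I))"

end

(* Let F and G be bases of the lattices generated by u and v, and write U = F A and V = G B.  The
   integer matrices A and B have integer right inverses A' and B', and the hypothesis on the rows
   of V says that A B^T = 0 and that B has n - rank A rows.  Multiplicativity of Gram determinants
   gives |u_I| = |<u>| |det A_I| and |v_J| = |<v>| |det B_J|, so the claim is that complementary
   maximal minors of A and B agree up to sign.  The matrix N obtained by stacking A over B'^T is
   unimodular, since N [A' | B^T] is unitriangular by blocks.  With E_I the columns of the
   identity indexed by I and J the complement of I, the product N [E_I | B^T] is block triangular
   with determinant det A_I, while [E_I | E_J]^T [E_I | B^T] is block triangular with determinant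
   det B_J.

   A reduction modulo an echelon basis shows both that a subgroup of Z^N has a basis and that the
   index of M Z^m in Z^m is |det M|; the latter identifies a and b with quotient orders. *)
theory Submission
  imports Defs
begin

section \<open>Ranges and kernels of matrices\<close>

text \<open>The identities A A' = 1 and B B' = 1 say that \<open>A\<close> maps Z^n onto Z^r and
  that the image of B^T is a saturated sublattice. With A B^T = 0 and n = r + s this makes 0 -> Z^s
  -> Z^n -> Z^r -> 0, with the maps B^T and A, split exact, and N is the resulting isomorphism of
  Z^n with the sum of Z^r and Z^s. The rows of V are only known to span the kernel over the reals,
  so over the integers they may generate a proper sublattice of it. This is why bases F and G are
  split off: they absorb the covolumes of the generated lattices and leave the split pair A, B.
  Multiplying by 1/a^k turns the normalisation of \<open>Sym\<close> by the saturation into one by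
  the generated lattice, and likewise for \<open>Kir\<close>. The coefficients are then compared
  before the power is taken, so that \<open>power0\<close> is applied to equal numbers, vanishing
  minors included.\<close>

text \<open>Lattices and real subspaces are both written as ranges of matrices, so that an inclusion
  between them becomes a factorisation of matrices over the same ring.\<close>

definition mat_range :: "'a :: comm_ring_1 mat \<Rightarrow> 'a vec set" where
  "mat_range M = (\<lambda>x. M *\<^sub>v x) ` carrier_vec (dim_col M)"

text \<open>This is linear independence of the columns as a family, so a repeated column is
  excluded; \<open>lin_dep\<close> speaks of a set and does not see repetitions.\<close>

definition mat_inj :: "'a :: comm_ring_1 mat \<Rightarrow> bool" where
  "mat_inj M \<longleftrightarrow>
     (\<forall>x \<in> carrier_vec (dim_col M). M *\<^sub>v x = 0\<^sub>v (dim_row M) \<longrightarrow> x = 0\<^sub>v (dim_col M))"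

lemma mat_range_carrier: "mat_range M \<subseteq> carrier_vec (dim_row M)"
  by (auto simp: mat_range_def intro: mult_mat_vec_carrier[OF carrier_matI[OF refl refl]])

lemma mat_rangeI: "M \<in> carrier_mat n m \<Longrightarrow> x \<in> carrier_vec m \<Longrightarrow> M *\<^sub>v x \<in> mat_range M"
  by (auto simp: mat_range_def)

lemma mat_rangeE:
  assumes "y \<in> mat_range M" "M \<in> carrier_mat n m"
  obtains x where "x \<in> carrier_vec m" "y = M *\<^sub>v x"
  using assms by (auto simp: mat_range_def)

lemma mat_injD:
  assumes "mat_inj M" "M \<in> carrier_mat n m" "x \<in> carrier_vec m" "M *\<^sub>v x = 0\<^sub>v n"
  shows "x = 0\<^sub>v m"
  using assms by (auto simp: mat_inj_def)

lemma mult_unit_vec_col: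
  fixes M :: "'a :: comm_ring_1 mat"
  assumes "M \<in> carrier_mat n m" "j < m"
  shows "M *\<^sub>v unit_vec m j = col M j"
  using assms by (intro eq_vecI) auto

lemma mat_eq_colI:
  assumes "X \<in> carrier_mat n m" "Y \<in> carrier_mat n m" "\<And>j. j < m \<Longrightarrow> col X j = col Y j"
  shows "X = Y"
  using assms by (intro mat_col_eqI) auto

lemma col_in_mat_range:
  assumes "M \<in> carrier_mat n m" "j < m"
  shows "col M j \<in> mat_range M"
  using mat_rangeI[OF assms(1), of "unit_vec m j"] mult_unit_vec_col[OF assms] by simp

text \<open>The coefficient vectors of the columns of \<open>X\<close> are the columns of
  \<open>M\<close>. Every matrix relating two lattices below is obtained in this way.\<close>

lemma mat_range_subset_factor:
  fixes X Y :: "'a :: comm_ring_1 mat"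
  assumes X: "X \<in> carrier_mat n m" and Y: "Y \<in> carrier_mat n l"
    and cols: "\<And>j. j < m \<Longrightarrow> col X j \<in> mat_range Y"
  obtains M where "M \<in> carrier_mat l m" "X = Y * M"
proof -
  have "\<exists>c. c \<in> carrier_vec l \<and> Y *\<^sub>v c = col X j" if "j < m" for j
    using cols[OF that] Y by (auto simp: mat_range_def)
  then obtain c where c: "\<And>j. j < m \<Longrightarrow> c j \<in> carrier_vec l \<and> Y *\<^sub>v c j = col X j"
    by metis
  define M where "M = mat_of_cols l (map c [0..<m])"
  have M: "M \<in> carrier_mat l m" by (auto simp: M_def)
  have colM: "col M j = c j" if "j < m" for j
    using that c by (simp add: M_def)
  have "X = Y * M"
  proof (rule mat_eq_colI[OF X])
    show "Y * M \<in> carrier_mat n m" using Y M by simp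
    fix j assume j: "j < m"
    have "col (Y * M) j = Y *\<^sub>v col M j" by (rule col_mult2[OF Y M j])
    then show "col X j = col (Y * M) j" using c[OF j] colM[OF j] by simp
  qed
  then show ?thesis using M that by blast
qed

lemma vec_eq_if_diff_zero:
  fixes x y :: "'a :: group_add vec"
  assumes "x \<in> carrier_vec n" "y \<in> carrier_vec n" and z: "x - y = 0\<^sub>v n"
  shows "x = y"
proof (rule eq_vecI)
  show "dim_vec x = dim_vec y" using assms by simp
  fix i assume i: "i < dim_vec y"
  then have "(x - y) $ i = 0" using z assms by simp
  moreover have "(x - y) $ i = x $ i - y $ i" using i by simp
  ultimately show "x $ i = y $ i" by simp
qed

text \<open>An injective integer matrix need not have an integer left inverse, so cancellation is
  derived from the trivial kernel, column by column.\<close>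

lemma mat_inj_cancel:
  fixes F X Y :: "'a :: comm_ring_1 mat"
  assumes inj: "mat_inj F" and F: "F \<in> carrier_mat n m"
    and X: "X \<in> carrier_mat m l" and Y: "Y \<in> carrier_mat m l"
    and eq: "F * X = F * Y"
  shows "X = Y"
proof (rule mat_eq_colI[OF X Y])
  fix j assume j: "j < l"
  have cX: "col X j \<in> carrier_vec m" and cY: "col Y j \<in> carrier_vec m" using X Y j by auto
  have "F *\<^sub>v col X j = F *\<^sub>v col Y j"
    using col_mult2[OF F X j] col_mult2[OF F Y j] eq by simp
  then have "F *\<^sub>v (col X j - col Y j) = 0\<^sub>v n"
    using F cX cY by (simp add: mult_minus_distrib_mat_vec[OF F cX cY])
  then have z: "col X j - col Y j = 0\<^sub>v m"
    using mat_injD[OF inj F] cX cY by simp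
  show "col X j = col Y j" by (rule vec_eq_if_diff_zero[OF cX cY z])
qed

lemma mat_range_mult_subset:
  fixes Y M :: "'a :: comm_ring_1 mat"
  assumes Y: "Y \<in> carrier_mat n l" and M: "M \<in> carrier_mat l m"
  shows "mat_range (Y * M) \<subseteq> mat_range Y"
proof
  fix y assume "y \<in> mat_range (Y * M)"
  then obtain x where x: "x \<in> carrier_vec m" "y = (Y * M) *\<^sub>v x"
    by (rule mat_rangeE[where n = n and m = m]) (use Y M in auto)
  then have "y = Y *\<^sub>v (M *\<^sub>v x)" using Y M by simp
  then show "y \<in> mat_range Y" using mat_rangeI[OF Y] M x by auto
qed

text \<open>Padding to square matrices turns the inequality into the multiplicativity of the determinant.\<close>

lemma one_mat_factor_le:
  fixes X Y :: "'a :: idom mat"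
  assumes X: "X \<in> carrier_mat m n" and Y: "Y \<in> carrier_mat n m" and XY: "X * Y = 1\<^sub>m m"
  shows "m \<le> n"
proof (rule ccontr)
  assume "\<not> m \<le> n"
  then have nm: "n < m" by simp
  define d where "d = m - n"
  have m: "m = n + d" using nm d_def by simp
  have d0: "d > 0" using nm d_def by simp
  define X' where "X' = mat m m (\<lambda>(i,j). if j < n then X $$ (i,j) else 0)"
  define Y' where "Y' = mat m m (\<lambda>(i,j). if i < n then Y $$ (i,j) else 0)"
  have "X' * Y' = X * Y"
  proof (rule eq_matI)
    fix i j assume "i < dim_row (X * Y)" "j < dim_col (X * Y)"
    then have i: "i < m" and j: "j < m" using X Y by auto
    have "(X' * Y') $$ (i,j) = (\<Sum>k=0..<m. X' $$ (i,k) * Y' $$ (k,j))"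
      using i j by (simp add: X'_def Y'_def scalar_prod_def)
    also have "\<dots> = (\<Sum>k=0..<n. X' $$ (i,k) * Y' $$ (k,j))"
      using nm i j by (intro sum.mono_neutral_right) (auto simp: X'_def Y'_def)
    also have "\<dots> = (\<Sum>k=0..<n. X $$ (i,k) * Y $$ (k,j))"
      using nm i j by (intro sum.cong) (auto simp: X'_def Y'_def)
    also have "\<dots> = (X * Y) $$ (i,j)"
      using i j X Y by (simp add: scalar_prod_def)
    finally show "(X' * Y') $$ (i,j) = (X * Y) $$ (i,j)" .
  qed (use X Y in \<open>auto simp: X'_def Y'_def\<close>)
  then have "det (X' * Y') = 1" using XY by simp
  then have "det X' * det Y' = 1"
    using det_mult[of X' m Y'] by (simp add: X'_def Y'_def)
  \<comment> \<open>Column \<open>n\<close> of \<open>X'\<close> consists of padding only, so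
    \<open>X'\<close> annihilates the corresponding unit vector.\<close>
  moreover have "det X' = 0"
  proof -
    have X': "X' \<in> carrier_mat m m" by (simp add: X'_def)
    have "X' *\<^sub>v unit_vec m n = 0\<^sub>v m"
      using nm by (subst mult_unit_vec_col[OF X' nm], intro eq_vecI) (auto simp: X'_def)
    moreover have "unit_vec m n \<noteq> (0\<^sub>v m :: 'a vec)"
    proof
      assume "unit_vec m n = (0\<^sub>v m :: 'a vec)"
      then have "unit_vec m n $ n = (0\<^sub>v m :: 'a vec) $ n" by simp
      then show False using nm by simp
    qed
    ultimately show ?thesis
      using det_0_iff_vec_prod_zero[OF X'] by (metis unit_vec_carrier)
  qed
  ultimately show False by simp
qed

section \<open>Spans and linear independence in matrix form\<close>

context idom_vec
begin

lemma span_eq_mat_range: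
  assumes "set ws \<subseteq> carrier_vec n"
  shows "span (set ws) = mat_range (mat_of_cols n ws)"
proof -
  have d: "\<forall>w\<in>set ws. dim_vec w = n" using assms by auto
  have "lincomb_list c ws \<in> mat_range (mat_of_cols n ws)" for c
    unfolding lincomb_list_as_mat_mult[OF d] by (auto simp: mat_range_def)
  moreover have "y \<in> span_list ws" if y: "y \<in> mat_range (mat_of_cols n ws)" for y
  proof -
    obtain x where x: "x \<in> carrier_vec (length ws)" "y = mat_of_cols n ws *\<^sub>v x"
      using y by (auto simp: mat_range_def)
    have "vec (length ws) (\<lambda>i. x $ i) = x" using x by auto
    then have "y = lincomb_list (\<lambda>i. x $ i) ws"
      using lincomb_list_as_mat_mult[OF d, of "\<lambda>i. x $ i"] x by simp
    then show ?thesis by (auto simp: span_list_def)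
  qed
  ultimately show ?thesis
    unfolding span_list_as_span[OF assms, symmetric] by (auto simp: span_list_def)
qed

lemma lin_indpt_iff_mat_inj:
  assumes ws: "set ws \<subseteq> carrier_vec n" and dist: "distinct ws"
  shows "\<not> lin_dep (set ws) \<longleftrightarrow> mat_inj (mat_of_cols n ws)"
proof
  have d: "\<forall>w\<in>set ws. dim_vec w = n" using ws by auto
  assume ind: "\<not> lin_dep (set ws)"
  show "mat_inj (mat_of_cols n ws)"
    unfolding mat_inj_def
  proof (intro ballI impI)
    fix x assume x: "x \<in> carrier_vec (dim_col (mat_of_cols n ws))"
      and 0: "mat_of_cols n ws *\<^sub>v x = 0\<^sub>v (dim_row (mat_of_cols n ws))"
    have xl: "dim_vec x = length ws" using x by simp
    \<comment> \<open>The coefficient vector \<open>x\<close> becomes a function on the vectors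
      themselves; distinctness makes the position of a vector unique.\<close>
    define f where "f w = x $ (THE i. i < length ws \<and> ws ! i = w)" for w
    have f: "f (ws ! i) = x $ i" if "i < length ws" for i
      unfolding f_def using that dist by (subst the_equality[of _ i]) (auto simp: nth_eq_iff_index_eq)
    have "vec (length ws) (\<lambda>i. f (ws ! i)) = x" using f xl by auto
    then have "lincomb f (set ws) = 0\<^sub>v n"
      unfolding lincomb_as_lincomb_list_distinct[OF ws dist] lincomb_list_as_mat_mult[OF d]
      using 0 by simp
    then have "f w = 0" if "w \<in> set ws" for w
      using ind that unfolding lin_dep_def by blast
    then show "x = 0\<^sub>v (dim_col (mat_of_cols n ws))"
      using f xl by (intro eq_vecI) (simp_all flip: f)
  qed
next
  have d: "\<forall>w\<in>set ws. dim_vec w = n" using ws by auto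
  assume inj: "mat_inj (mat_of_cols n ws)"
  show "\<not> lin_dep (set ws)"
  proof
    assume "lin_dep (set ws)"
    then obtain A f v where A: "A \<subseteq> set ws" "lincomb f A = 0\<^sub>v n" "v \<in> A" "f v \<noteq> 0"
      unfolding lin_dep_def by auto
    \<comment> \<open>Extension by zero turns a relation among some of the vectors into one among
      all of them.\<close>
    define g where "g x = (if x \<in> A then f x else 0)" for x
    have AC: "A \<subseteq> carrier_vec n" using A ws by auto
    have fA: "finite A" using A(1) finite_subset by blast
    have "lincomb g (set ws) = lincomb g (set ws - A) + lincomb g A"
      by (rule lincomb_vec_diff_add[OF ws A(1)]) auto
    moreover have "lincomb g (set ws - A) = 0\<^sub>v n"
      by (rule lincomb_zero) (use ws in \<open>auto simp: g_def\<close>)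
    moreover have "lincomb g A = lincomb f A"
      by (rule lincomb_cong) (use AC fA in \<open>auto simp: g_def\<close>)
    ultimately have "lincomb g (set ws) = 0\<^sub>v n" using A by simp
    then have "mat_of_cols n ws *\<^sub>v vec (length ws) (\<lambda>i. g (ws ! i)) = 0\<^sub>v n"
      unfolding lincomb_as_lincomb_list_distinct[OF ws dist] lincomb_list_as_mat_mult[OF d] .
    then have z: "vec (length ws) (\<lambda>i. g (ws ! i)) = 0\<^sub>v (length ws)"
      using inj by (auto simp: mat_inj_def)
    obtain i where i: "i < length ws" "ws ! i = v"
      using A by (metis in_set_conv_nth subsetD)
    have "vec (length ws) (\<lambda>i. g (ws ! i)) $ i = 0" using z i by simp
    then show False using i A by (simp add: g_def)
  qed
qed

end

section \<open>Echelon bases of integer lattices\<close>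

text \<open>A saturation is cut out by a condition over the reals and comes without generators, so
  bases have to be found for abstract subgroups.\<close>

definition int_subgroup :: "nat \<Rightarrow> int vec set \<Rightarrow> bool" where
  "int_subgroup N L \<longleftrightarrow>
     L \<subseteq> carrier_vec N \<and> 0\<^sub>v N \<in> L \<and> (\<forall>x \<in> L. \<forall>y \<in> L. x - y \<in> L)"

lemma int_subgroupD:
  assumes "int_subgroup N L"
  shows "x \<in> L \<Longrightarrow> x \<in> carrier_vec N" "0\<^sub>v N \<in> L" "x \<in> L \<Longrightarrow> y \<in> L \<Longrightarrow> x - y \<in> L"
  using assms by (auto simp: int_subgroup_def)

lemma int_subgroup_add:
  assumes L: "int_subgroup N L" and x: "x \<in> L" and y: "y \<in> L"
  shows "x + y \<in> L"
proof -
  have c: "x \<in> carrier_vec N" "y \<in> carrier_vec N" using int_subgroupD[OF L] x y by auto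
  have "x - (0\<^sub>v N - y) \<in> L" using int_subgroupD[OF L] x y by blast
  moreover have "x - (0\<^sub>v N - y) = x + y" using c by (intro eq_vecI) auto
  ultimately show ?thesis by simp
qed

lemma int_subgroup_smult:
  assumes L: "int_subgroup N L" and x: "x \<in> L"
  shows "c \<cdot>\<^sub>v x \<in> L"
proof -
  have xc: "x \<in> carrier_vec N" using int_subgroupD[OF L] x by auto
  show ?thesis
  proof (induction c rule: int_induct[where k = 0])
    case base
    have "0 \<cdot>\<^sub>v x = 0\<^sub>v N" using xc by auto
    then show ?case using int_subgroupD[OF L] by simp
  next
    case (step1 i)
    have "(i + 1) \<cdot>\<^sub>v x = i \<cdot>\<^sub>v x + x" using xc by (intro eq_vecI) (auto simp: algebra_simps)
    then show ?case using int_subgroup_add[OF L step1(2) x] by simp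
  next
    case (step2 i)
    have "(i - 1) \<cdot>\<^sub>v x = i \<cdot>\<^sub>v x - x" using xc by (intro eq_vecI) (auto simp: algebra_simps)
    then show ?case using int_subgroupD(3)[OF L step2(2) x] by simp
  qed
qed

lemma mult_mat_vec_zero:
  assumes "M \<in> carrier_mat n m"
  shows "M *\<^sub>v 0\<^sub>v m = 0\<^sub>v n"
  using assms by (intro eq_vecI) auto

lemma int_subgroup_mat_range:
  assumes M: "M \<in> carrier_mat N m"
  shows "int_subgroup N (mat_range M)"
  unfolding int_subgroup_def
proof (intro conjI ballI)
  show "mat_range M \<subseteq> carrier_vec N" using mat_range_carrier[of M] M by auto
  show "0\<^sub>v N \<in> mat_range M"
    using mat_rangeI[OF M, of "0\<^sub>v m"] M mult_mat_vec_zero[OF M] by simp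
  fix x y assume "x \<in> mat_range M" "y \<in> mat_range M"
  then obtain a b where ab: "a \<in> carrier_vec m" "x = M *\<^sub>v a" "b \<in> carrier_vec m" "y = M *\<^sub>v b"
    using M by (auto simp: mat_range_def)
  then have "x - y = M *\<^sub>v (a - b)" using M by (simp add: mult_minus_distrib_mat_vec)
  then show "x - y \<in> mat_range M" using mat_rangeI[OF M] ab by simp
qed

lemma mat_range_subset_int_subgroup:
  assumes L: "int_subgroup N L" and ws: "set ws \<subseteq> L"
  shows "mat_range (mat_of_cols N ws) \<subseteq> L"
proof -
  interpret idom_vec N "TYPE(int)" .
  have c: "set ws \<subseteq> carrier_vec N" using int_subgroupD(1)[OF L] ws by auto
  have sl: "M.sumlist xs \<in> L" if "set xs \<subseteq> L" for xs
    using that by (induction xs) (auto intro: int_subgroup_add[OF L] int_subgroupD(2)[OF L])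
  have "lincomb_list f ws \<in> L" for f
    unfolding lincomb_list_def
    by (rule sl) (use ws in \<open>auto intro!: int_subgroup_smult[OF L]\<close>)
  then show ?thesis
    unfolding span_eq_mat_range[OF c, symmetric] span_list_as_span[OF c, symmetric] span_list_def
    by auto
qed

text \<open>The leading coefficients at position \<open>j\<close> form an ideal of the integers; a generator is
  attained by some \<open>y\<close>.\<close>

lemma int_subgroup_pivot:
  assumes L: "int_subgroup N L" and j: "j < N"
  shows "\<exists>y \<in> L. (\<forall>i<j. y $ i = 0) \<and> 0 \<le> y $ j \<and> (y $ j = 0 \<longrightarrow> y = 0\<^sub>v N) \<and>
           (\<forall>x \<in> L. (\<forall>i<j. x $ i = 0) \<longrightarrow> y $ j dvd x $ j)"
proof (cases "\<exists>y \<in> L. (\<forall>i<j. y $ i = 0) \<and> 0 < y $ j")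
  \<comment> \<open>By negation no leading coefficient is negative either, so all of them are zero
    and the zero vector serves as generator.\<close>
  case False
  have "x $ j = 0" if x: "x \<in> L" "\<forall>i<j. x $ i = 0" for x
  proof (rule ccontr)
    assume "x $ j \<noteq> 0"
    then have neg: "x $ j < 0" using False x by force
    have xc: "x \<in> carrier_vec N" using int_subgroupD[OF L] x by auto
    have "(-1) \<cdot>\<^sub>v x \<in> L" by (rule int_subgroup_smult[OF L x(1)])
    moreover have "\<forall>i<j. ((-1) \<cdot>\<^sub>v x) $ i = 0" "0 < ((-1) \<cdot>\<^sub>v x) $ j"
      using xc j x neg by auto
    ultimately show False using False by blast
  qed
  then show ?thesis
    using int_subgroupD(2)[OF L] j by (intro bexI[of _ "0\<^sub>v N"]) auto
next
  case True
  define P where "P d \<longleftrightarrow> (\<exists>y \<in> L. (\<forall>i<j. y $ i = 0) \<and> 0 < y $ j \<and> nat (y $ j) = d)" for d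
  have "\<exists>d. P d" using True by (auto simp: P_def)
  then have "P (Least P)" by (metis LeastI)
  then obtain y where y: "y \<in> L" "\<forall>i<j. y $ i = 0" "0 < y $ j" "nat (y $ j) = Least P"
    by (auto simp: P_def)
  have yc: "y \<in> carrier_vec N" using int_subgroupD[OF L] y by auto
  have "y $ j dvd x $ j" if x: "x \<in> L" "\<forall>i<j. x $ i = 0" for x
  proof (rule ccontr)
    assume nd: "\<not> y $ j dvd x $ j"
    have xc: "x \<in> carrier_vec N" using int_subgroupD[OF L] x by auto
    \<comment> \<open>Euclidean division: a nonzero remainder would be a smaller positive leading
      coefficient than the minimal one.\<close>
    define z where "z = x - (x $ j div y $ j) \<cdot>\<^sub>v y"
    have zL: "z \<in> L" unfolding z_def
      by (intro int_subgroupD(3)[OF L] int_subgroup_smult[OF L] x y)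
    have zi: "\<forall>i<j. z $ i = 0" using x y xc yc j by (auto simp: z_def)
    have "z $ j = x $ j - (x $ j div y $ j) * y $ j" using xc yc j by (simp add: z_def)
    then have zj: "z $ j = x $ j mod y $ j" by (simp add: minus_div_mult_eq_mod)
    have "0 < z $ j" using zj nd y(3) by (metis dvd_eq_mod_eq_0 pos_mod_sign order_le_less)
    then have "P (nat (z $ j))" using zL zi by (auto simp: P_def)
    moreover have "nat (z $ j) < Least P" using zj y(3,4) pos_mod_bound[OF y(3), of "x $ j"]
      by (metis nat_less_eq_zless pos_mod_sign)
    ultimately show False using not_less_Least by blast
  qed
  then show ?thesis using y by (intro bexI[of _ y]) auto
qed

text \<open>The coordinates are treated from left to right: \<open>y k\<close> vanishes before
  position \<open>k\<close>, so subtracting a multiple of it leaves the coordinates already reduced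
  unchanged. \<open>S\<close> is the span of the pivot vectors when a basis is constructed, and the
  whole lattice when cosets are counted.\<close>

lemma echelon_reduce:
  assumes S: "int_subgroup N S" and k: "k \<le> N" and x: "x \<in> carrier_vec N"
    and y: "\<And>j. j < N \<Longrightarrow> y j \<in> S" "\<And>i j. i < j \<Longrightarrow> j < N \<Longrightarrow> y j $ i = 0"
      "\<And>j. j < N \<Longrightarrow> 0 \<le> y j $ j"
  shows "\<exists>z \<in> S. \<forall>i<k. y i $ i \<noteq> 0 \<longrightarrow> 0 \<le> (x - z) $ i \<and> (x - z) $ i < y i $ i"
  using k
proof (induction k)
  case 0
  then show ?case using int_subgroupD(2)[OF S] by auto
next
  case (Suc k)
  then obtain z where z: "z \<in> S"
    "\<And>i. i < k \<Longrightarrow> y i $ i \<noteq> 0 \<Longrightarrow> 0 \<le> (x - z) $ i \<and> (x - z) $ i < y i $ i"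
    by (auto simp: less_Suc_eq_le)
  have kN: "k < N" using Suc by simp
  have c: "z \<in> carrier_vec N" "y k \<in> carrier_vec N"
    using int_subgroupD(1)[OF S] z y(1)[OF kN] by auto
  \<comment> \<open>The quotient whose remainder is the new coordinate \<open>k\<close>, between
    zero and the pivot.\<close>
  define q where "q = (x - z) $ k div y k $ k"
  define z' where "z' = z + q \<cdot>\<^sub>v y k"
  have diff: "(x - z') $ i = (x - z) $ i - q * y k $ i" if "i < N" for i
    using that c x by (simp add: z'_def)
  have "z' \<in> S" unfolding z'_def
    by (intro int_subgroup_add[OF S] int_subgroup_smult[OF S] z(1) y(1) kN)
  moreover have "0 \<le> (x - z') $ i \<and> (x - z') $ i < y i $ i" if i: "i < Suc k" "y i $ i \<noteq> 0" for i
  proof (cases "i = k")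
    case True
    have "(x - z') $ k = (x - z) $ k mod y k $ k"
      using diff[OF kN] by (simp add: q_def minus_div_mult_eq_mod)
    moreover have "0 < y k $ k" using y(3)[OF kN] i True by simp
    ultimately show ?thesis using True by simp
  next
    case False
    then have ik: "i < k" using i by simp
    then have "(x - z') $ i = (x - z) $ i" using diff[of i] kN y(2)[OF ik kN] by simp
    then show ?thesis using z(2)[OF ik i(2)] by simp
  qed
  ultimately show ?case by auto
qed

text \<open>Once the earlier coordinates vanish, the next one is divisible by its pivot and smaller
  than it, hence zero; a zero pivot forces this by divisibility alone. The bound is on absolute
  values so that it covers the difference of two reduced vectors.\<close>

lemma echelon_zero:
  assumes L: "int_subgroup N L" and x: "x \<in> L"
    and y: "\<And>j x. j < N \<Longrightarrow> x \<in> L \<Longrightarrow> (\<forall>i<j. x $ i = 0) \<Longrightarrow> y j $ j dvd x $ j"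
    and small: "\<And>i. i < N \<Longrightarrow> y i $ i \<noteq> (0::int) \<Longrightarrow> \<bar>x $ i\<bar> < \<bar>y i $ i\<bar>"
  shows "x = 0\<^sub>v N"
proof -
  have xc: "x \<in> carrier_vec N" using int_subgroupD[OF L] x by auto
  have "x $ i = 0" if "i < N" for i
    using that
  proof (induction i rule: less_induct)
    case (less i)
    then have d: "y i $ i dvd x $ i" using y[OF less.prems x] by auto
    show ?case
    proof (cases "y i $ i = 0")
      case False
      then show ?thesis using small[OF less.prems] d dvd_imp_le_int[of "x $ i" "y i $ i"] by force
    qed (use d in simp)
  qed
  then show ?thesis using xc by (intro eq_vecI) auto
qed

text \<open>In essence a Hermite normal form without the reduction of the off-diagonal entries.
  There is one vector for every coordinate; a zero pivot marks a coordinate that contributes no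
  basis vector.\<close>

definition echelon_pivots :: "nat \<Rightarrow> int vec set \<Rightarrow> (nat \<Rightarrow> int vec) \<Rightarrow> bool" where
  "echelon_pivots N L y \<longleftrightarrow>
     (\<forall>j<N. y j \<in> L \<and> (\<forall>i<j. y j $ i = 0) \<and> 0 \<le> y j $ j \<and>
        (\<forall>x \<in> L. (\<forall>i<j. x $ i = 0) \<longrightarrow> y j $ j dvd x $ j))"

lemma echelon_pivotsD:
  assumes "echelon_pivots N L y" "j < N"
  shows "y j \<in> L" "i < j \<Longrightarrow> y j $ i = 0" "0 \<le> y j $ j"
    "x \<in> L \<Longrightarrow> (\<forall>i<j. x $ i = 0) \<Longrightarrow> y j $ j dvd x $ j"
  using assms by (auto simp: echelon_pivots_def)

text \<open>Reducing an element of \<open>L\<close> modulo the pivot vectors leaves a remainder that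
  still lies in \<open>L\<close> and is smaller than every nonzero pivot, so
  \<open>echelon_zero\<close> makes it vanish.\<close>

lemma echelon_basis_exists:
  assumes L: "int_subgroup N L"
  obtains y where "echelon_pivots N L y"
    "mat_range (mat_of_cols N (map y (filter (\<lambda>j. y j $ j \<noteq> 0) [0..<N]))) = L"
proof -
  have "\<forall>j. \<exists>y. j < N \<longrightarrow> (y \<in> L \<and> (\<forall>i<j. y $ i = 0) \<and> 0 \<le> y $ j \<and> (y $ j = 0 \<longrightarrow> y = 0\<^sub>v N) \<and>
           (\<forall>x \<in> L. (\<forall>i<j. x $ i = 0) \<longrightarrow> y $ j dvd x $ j))"
    using int_subgroup_pivot[OF L] by blast
  then obtain y where y: "\<And>j. j < N \<Longrightarrow> (y j \<in> L \<and> (\<forall>i<j. y j $ i = 0) \<and> 0 \<le> y j $ j \<and>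
       (y j $ j = 0 \<longrightarrow> y j = 0\<^sub>v N) \<and> (\<forall>x \<in> L. (\<forall>i<j. x $ i = 0) \<longrightarrow> y j $ j dvd x $ j))"
    by metis
  define ws where "ws = map y (filter (\<lambda>j. y j $ j \<noteq> 0) [0..<N])"
  have wsL: "set ws \<subseteq> L" using y by (auto simp: ws_def)
  have wsc: "set ws \<subseteq> carrier_vec N" using wsL int_subgroupD(1)[OF L] by auto
  define S where "S = mat_range (mat_of_cols N ws)"
  have S: "int_subgroup N S" unfolding S_def by (rule int_subgroup_mat_range) (rule mat_of_cols_carrier)
  have SL: "S \<subseteq> L" unfolding S_def by (rule mat_range_subset_int_subgroup[OF L wsL])
  have wsS: "w \<in> S" if "w \<in> set ws" for w
  proof -
    obtain i where i: "i < length ws" "ws ! i = w" using \<open>w \<in> set ws\<close> by (auto simp: in_set_conv_nth)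
    then have "col (mat_of_cols N ws) i = w"
      using wsc by (metis col_mat_of_cols nth_mem subsetD)
    then show ?thesis unfolding S_def
      using col_in_mat_range[OF mat_of_cols_carrier(1), of i ws N] i by simp
  qed
  have yS: "y j \<in> S" if "j < N" for j
  proof (cases "y j $ j = 0")
    \<comment> \<open>A pivot vector with zero pivot was chosen to be the zero vector, so dropping
      it from \<open>ws\<close> loses nothing.\<close>
    case True
    then show ?thesis using y[OF that] int_subgroupD(2)[OF S] by simp
  next
    case False
    then show ?thesis using that by (intro wsS) (auto simp: ws_def)
  qed
  have "x \<in> S" if x: "x \<in> L" for x
  proof -
    have xc: "x \<in> carrier_vec N" using int_subgroupD[OF L] x by auto
    obtain z where z: "z \<in> S"
      "\<And>i. i < N \<Longrightarrow> y i $ i \<noteq> 0 \<Longrightarrow> 0 \<le> (x - z) $ i \<and> (x - z) $ i < y i $ i"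
      using echelon_reduce[OF S order_refl xc, of y] yS y by blast
    have zc: "z \<in> carrier_vec N" using int_subgroupD[OF S] z by auto
    have "x - z = 0\<^sub>v N"
      by (rule echelon_zero[OF L, of _ y])
        (use x z SL y in \<open>force intro: int_subgroupD(3)[OF L]\<close>)+
    then have "x = z" by (rule vec_eq_if_diff_zero[OF xc zc])
    then show ?thesis using z by simp
  qed
  then have "S = L" using SL by auto
  then show ?thesis using that[of y] y by (auto simp: echelon_pivots_def S_def ws_def)
qed

text \<open>Forward substitution along the staircase: in row \<open>js ! i\<close> the columns after
  \<open>i\<close> vanish, and the coefficients before \<open>i\<close> are already known to be
  zero.\<close>

lemma echelon_mat_inj:
  assumes y: "\<And>j. j < N \<Longrightarrow> y j \<in> carrier_vec N"
      "\<And>i j. i < j \<Longrightarrow> j < N \<Longrightarrow> y j $ i = (0::int)"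
  shows "mat_inj (mat_of_cols N (map y (filter (\<lambda>j. y j $ j \<noteq> 0) [0..<N])))"
proof -
  define js where "js = filter (\<lambda>j. y j $ j \<noteq> 0) [0..<N]"
  have js: "js ! i < N" "y (js ! i) $ (js ! i) \<noteq> 0" if "i < length js" for i
    using nth_mem[OF that] by (auto simp: js_def)
  have srt: "js ! i < js ! k" if "i < k" "k < length js" for i k
    using that sorted_wrt_filter[OF sorted_wrt_upt, of "\<lambda>j. y j $ j \<noteq> 0" 0 N]
    unfolding js_def[symmetric] sorted_wrt_iff_nth_less by blast
  let ?M = "mat_of_cols N (map y js)"
  have "c = 0\<^sub>v (length js)" if c: "c \<in> carrier_vec (length js)" "?M *\<^sub>v c = 0\<^sub>v N" for c
  proof -
    have "c $ i = 0" if "i < length js" for i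
      using that
    proof (induction i rule: less_induct)
      case (less i)
      note i = less.prems
      have "0 = (?M *\<^sub>v c) $ (js ! i)" using c js[OF i] by simp
      also have "\<dots> = (\<Sum>k=0..<length js. y (js ! k) $ (js ! i) * c $ k)"
        using js[OF i] c(1) by (simp add: scalar_prod_def mat_of_cols_index)
      also have "\<dots> = (\<Sum>k\<in>{i}. y (js ! k) $ (js ! i) * c $ k)"
      proof (rule sum.mono_neutral_right)
        show "\<forall>k \<in> {0..<length js} - {i}. y (js ! k) $ (js ! i) * c $ k = 0"
        proof
          fix k assume k: "k \<in> {0..<length js} - {i}"
          show "y (js ! k) $ (js ! i) * c $ k = 0"
          proof (cases "k < i")
            case True
            then show ?thesis using less.IH[of k] k by simp
          next
            case False
            then have "js ! i < js ! k" "js ! k < N" using srt[of i k] js(1)[of k] k by auto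
            then show ?thesis using y(2) by simp
          qed
        qed
      qed (use i in auto)
      finally show ?case using js[OF i] by simp
    qed
    then show ?thesis using c by (intro eq_vecI) auto
  qed
  then show ?thesis unfolding mat_inj_def js_def[symmetric] by simp
qed

section \<open>Indices as determinants\<close>

text \<open>The summand \<open>x\<close> stands on the right to agree with the right cosets that
  make up the quotient group in \<open>quotient_order\<close>.\<close>

definition vec_coset :: "int vec set \<Rightarrow> int vec \<Rightarrow> int vec set" where
  "vec_coset L x = (\<lambda>h. h + x) ` L"

lemma vec_coset_eq_iff:
  assumes L: "int_subgroup N L" and x: "x \<in> carrier_vec N" and y: "y \<in> carrier_vec N"
  shows "vec_coset L x = vec_coset L y \<longleftrightarrow> x - y \<in> L"
proof
  assume eq: "vec_coset L x = vec_coset L y"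
  have "0\<^sub>v N + x \<in> vec_coset L x" using int_subgroupD(2)[OF L] by (auto simp: vec_coset_def)
  then obtain h where h: "h \<in> L" "0\<^sub>v N + x = h + y" using eq by (auto simp: vec_coset_def)
  have "x - y = h"
  proof (rule eq_vecI)
    have hc: "h \<in> carrier_vec N" using int_subgroupD(1)[OF L h(1)] .
    show "dim_vec (x - y) = dim_vec h" using hc y by simp
    fix i assume "i < dim_vec h"
    then have i: "i < N" using hc by simp
    have "(0\<^sub>v N + x) $ i = (h + y) $ i" using h by simp
    then show "(x - y) $ i = h $ i" using i x y hc by simp
  qed
  then show "x - y \<in> L" using h by simp
next
  have sub: "vec_coset L x \<subseteq> vec_coset L y"
    if xy: "x - y \<in> L" and c: "x \<in> carrier_vec N" "y \<in> carrier_vec N" for x y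
  proof
    fix z assume "z \<in> vec_coset L x"
    then obtain h where h: "h \<in> L" "z = h + x" by (auto simp: vec_coset_def)
    have "z = (h + (x - y)) + y" using h c int_subgroupD(1)[OF L h(1)] by (intro eq_vecI) auto
    then show "z \<in> vec_coset L y"
      using int_subgroup_add[OF L h(1) xy] by (auto simp: vec_coset_def)
  qed
  assume xy: "x - y \<in> L"
  have "(-1) \<cdot>\<^sub>v (x - y) \<in> L" by (rule int_subgroup_smult[OF L xy])
  moreover have "(-1) \<cdot>\<^sub>v (x - y) = y - x" using x y by (intro eq_vecI) auto
  ultimately show "vec_coset L x = vec_coset L y" using sub[OF xy x y] sub[OF _ y x] by auto
qed

lemma card_box_vec:
  "card {x \<in> carrier_vec m. \<forall>i<m. 0 \<le> x $ i \<and> x $ i < d i} = (\<Prod>i<m. nat (d i))"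
proof -
  let ?B = "{x \<in> carrier_vec m. \<forall>i<m. 0 \<le> x $ i \<and> x $ i < d i}"
  have "bij_betw (\<lambda>f. vec m f) (PiE {..<m} (\<lambda>i. {0..<d i})) ?B"
  proof (rule bij_betw_byWitness[where f' = "\<lambda>x. restrict (\<lambda>i. x $ i) {..<m}"])
    show "\<forall>a\<in>PiE {..<m} (\<lambda>i. {0..<d i}). restrict (\<lambda>i. vec m a $ i) {..<m} = a"
      by (auto simp: fun_eq_iff restrict_def PiE_def extensional_def)
    show "\<forall>a'\<in>?B. vec m (restrict (\<lambda>i. a' $ i) {..<m}) = a'"
      by auto
    show "(\<lambda>f. vec m f) ` (PiE {..<m} (\<lambda>i. {0..<d i})) \<subseteq> ?B"
      by (force simp: PiE_def Pi_def)
    show "(\<lambda>x. restrict (\<lambda>i. x $ i) {..<m}) ` ?B \<subseteq> PiE {..<m} (\<lambda>i. {0..<d i})"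
      by (auto simp: PiE_def extensional_def)
  qed
  then have "card ?B = card (PiE {..<m} (\<lambda>i. {0..<d i}))" by (simp add: bij_betw_same_card)
  also have "\<dots> = (\<Prod>i<m. nat (d i))" by (simp add: card_PiE)
  finally show ?thesis .
qed

lemma int_det_factor_one:
  fixes P Q :: "int mat"
  assumes P: "P \<in> carrier_mat m m" and Q: "Q \<in> carrier_mat m m" and PQ: "P * Q = 1\<^sub>m m"
  shows "\<bar>det P\<bar> = 1"
proof -
  have "det P * det Q = 1" using det_mult[OF P Q] PQ by simp
  then show ?thesis using abs_zmult_eq_1[of "det P" "det Q"] by simp
qed

lemma det_nonzero_mat_inj:
  fixes M :: "'a :: idom mat"
  assumes M: "M \<in> carrier_mat m m" and d: "det M \<noteq> 0"
  shows "mat_inj M"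
  using det_0_iff_vec_prod_zero[OF M] d M by (auto simp: mat_inj_def)

text \<open>\<open>M\<close> is replaced by a triangular matrix \<open>T\<close> with the same
  range. The two differ by a unimodular factor, and the box with the diagonal entries of
  \<open>T\<close> as side lengths is a system of representatives.\<close>

lemma card_cosets_mat_range:
  fixes M :: "int mat"
  assumes M: "M \<in> carrier_mat m m" and d: "det M \<noteq> 0"
  shows "card (vec_coset (mat_range M) ` carrier_vec m) = nat \<bar>det M\<bar>"
proof -
  define L where "L = mat_range M"
  have L: "int_subgroup m L" unfolding L_def by (rule int_subgroup_mat_range[OF M])
  obtain y where piv: "echelon_pivots m L y"
    and rng: "mat_range (mat_of_cols m (map y (filter (\<lambda>j. y j $ j \<noteq> 0) [0..<m]))) = L"
    by (rule echelon_basis_exists[OF L])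
  note y = echelon_pivotsD[OF piv]
  have nz: "y j $ j \<noteq> 0" if j: "j < m" for j
  proof -
    \<comment> \<open>The adjugate puts \<open>det M\<close> times each unit vector into the
      lattice, so every pivot divides \<open>det M\<close> and is nonzero.\<close>
    have "M * adj_mat M = det M \<cdot>\<^sub>m 1\<^sub>m m" "adj_mat M \<in> carrier_mat m m"
      using adj_mat[OF M] by auto
    then have "M *\<^sub>v col (adj_mat M) j = col (det M \<cdot>\<^sub>m 1\<^sub>m m) j"
      using col_mult2[OF M _ j] by metis
    moreover have "M *\<^sub>v col (adj_mat M) j \<in> L" unfolding L_def
      by (rule mat_rangeI[OF M]) (use adj_mat[OF M] j in auto)
    ultimately have "y j $ j dvd col (det M \<cdot>\<^sub>m 1\<^sub>m m) j $ j"
      by (intro y(4)[OF j]) (use j in auto)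
    then show ?thesis using d j by auto
  qed
  have pos: "0 < y j $ j" if "j < m" for j using y(3)[OF that] nz[OF that] by simp
  define T where "T = mat_of_cols m (map y [0..<m])"
  have T: "T \<in> carrier_mat m m" by (rule carrier_matI) (simp_all add: T_def)
  have "filter (\<lambda>j. y j $ j \<noteq> 0) [0..<m] = [0..<m]" using nz by simp
  then have rT: "mat_range T = L" using rng by (simp add: T_def)
  have detT: "det T = (\<Prod>j<m. y j $ j)"
  proof -
    have "det T = prod_list (diag_mat T)"
      by (rule det_lower_triangular[OF _ T]) (use y(2) in \<open>auto simp: T_def mat_of_cols_index\<close>)
    also have "diag_mat T = map (\<lambda>j. y j $ j) [0..<m]"
      by (auto simp: diag_mat_def T_def mat_of_cols_index)
    also have "prod_list \<dots> = (\<Prod>j<m. y j $ j)"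
      by (simp add: prod.distinct_set_conv_list[symmetric] atLeast0LessThan)
    finally show ?thesis .
  qed
  obtain P where P: "P \<in> carrier_mat m m" "T = M * P"
    by (rule mat_range_subset_factor[OF T M]) (use col_in_mat_range[OF T] rT L_def in auto)
  obtain Q where Q: "Q \<in> carrier_mat m m" "M = T * Q"
    by (rule mat_range_subset_factor[OF M T]) (use col_in_mat_range[OF M] rT L_def in auto)
  \<comment> \<open>\<open>M\<close> and \<open>T\<close> factor through each other; cancelling
    \<open>M\<close> makes \<open>P\<close> and \<open>Q\<close> mutually inverse, hence
    unimodular.\<close>
  have "M * (P * Q) = M * 1\<^sub>m m" 
    using assoc_mult_mat[OF M P(1) Q(1)] right_mult_one_mat[OF M] P(2) Q(2) by metis
  then have "P * Q = 1\<^sub>m m"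
    by (rule mat_inj_cancel[OF det_nonzero_mat_inj[OF M d] M, rotated 2]) (use P Q in auto)
  from int_det_factor_one[OF P(1) Q(1) this] have "\<bar>det T\<bar> = \<bar>det M\<bar>"
    using det_mult[OF M P(1)] P(2) by (simp add: abs_mult)
  moreover have "det T > 0" unfolding detT by (rule prod_pos) (use pos in auto)
  moreover have "int (\<Prod>j<m. nat (y j $ j)) = det T"
    unfolding detT using pos by (simp add: order_less_imp_le)
  ultimately have detM: "nat \<bar>det M\<bar> = (\<Prod>j<m. nat (y j $ j))" by linarith
  \<comment> \<open>The box of reduced vectors: two of them in one coset differ by a lattice vector
    that is too small to be nonzero, and every coset contains one by reduction.\<close>
  define R where "R = {x \<in> carrier_vec m. \<forall>i<m. 0 \<le> x $ i \<and> x $ i < y i $ i}"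
  have "inj_on (vec_coset L) R"
  proof (rule inj_onI)
    fix a b assume ab: "a \<in> R" "b \<in> R" "vec_coset L a = vec_coset L b"
    then have c: "a \<in> carrier_vec m" "b \<in> carrier_vec m" by (auto simp: R_def)
    have "a - b \<in> L" using vec_coset_eq_iff[OF L c] ab by simp
    then have "a - b = 0\<^sub>v m"
    proof (rule echelon_zero[OF L, where y = y])
      fix i assume i: "i < m"
      then have "0 \<le> a $ i" "a $ i < y i $ i" "0 \<le> b $ i" "b $ i < y i $ i"
        using ab by (auto simp: R_def)
      then show "\<bar>(a - b) $ i\<bar> < \<bar>y i $ i\<bar>" using i c by simp
    qed (use y(4) in blast)
    then show "a = b" by (rule vec_eq_if_diff_zero[OF c])
  qed
  moreover have "vec_coset L ` R = vec_coset L ` carrier_vec m"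
  proof
    show "vec_coset L ` carrier_vec m \<subseteq> vec_coset L ` R"
    proof
      fix C assume "C \<in> vec_coset L ` carrier_vec m"
      then obtain x where x: "x \<in> carrier_vec m" "C = vec_coset L x" by auto
      obtain z where z: "z \<in> L" "\<And>i. i < m \<Longrightarrow> 0 \<le> (x - z) $ i \<and> (x - z) $ i < y i $ i"
        using echelon_reduce[OF L order_refl x(1), of y] y nz by metis
      have zc: "z \<in> carrier_vec m" by (rule int_subgroupD(1)[OF L z(1)])
      have "x - z \<in> R" using z x zc by (auto simp: R_def)
      moreover have "x - (x - z) = z" using x zc by (intro eq_vecI) auto
      then have "C = vec_coset L (x - z)"
        using vec_coset_eq_iff[OF L x(1), of "x - z"] x z zc by simp
      ultimately show "C \<in> vec_coset L ` R" by auto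
    qed
  qed (auto simp: R_def)
  ultimately have "card (vec_coset L ` carrier_vec m) = card R" by (metis card_image)
  then show ?thesis using detM card_box_vec[of m "\<lambda>i. y i $ i"] by (simp add: L_def R_def)
qed

lemma quotient_order_eq:
  "quotient_order N A B = card (vec_coset B ` A)"
proof -
  have "carrier ((module_vec TYPE(int) N)\<lparr>carrier := A\<rparr> A_Mod B) = vec_coset B ` A"
    unfolding A_FactGroup_def FactGroup_def A_RCOSETS_defs a_r_coset_def r_coset_def vec_coset_def
    by (auto simp: module_vec_def image_def Bex_def)
  then show ?thesis by (simp add: quotient_order_def Coset.order_def)
qed

text \<open>The injective map \<open>S\<close> carries Z^m to \<open>mat_range S\<close> and the
  range of \<open>M\<close> to that of \<open>S * M\<close>, so it matches the cosets on both sides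
  and reduces the claim to \<open>card_cosets_mat_range\<close>.\<close>

lemma quotient_order_mat_range:
  fixes S M :: "int mat"
  assumes S: "S \<in> carrier_mat N m" and inj: "mat_inj S"
    and M: "M \<in> carrier_mat m m" and d: "det M \<noteq> 0"
  shows "quotient_order N (mat_range S) (mat_range (S * M)) = nat \<bar>det M\<bar>"
proof -
  have injS: "inj_on (mult_mat_vec S) (carrier_vec m)"
  proof (rule inj_onI)
    fix x y assume c: "x \<in> carrier_vec m" "y \<in> carrier_vec m" and eq: "S *\<^sub>v x = S *\<^sub>v y"
    have "S *\<^sub>v (x - y) = 0\<^sub>v N"
      using eq S c by (simp add: mult_minus_distrib_mat_vec[OF S c])
    then have "x - y = 0\<^sub>v m" by (intro mat_injD[OF inj S]) (use c in auto)
    then show "x = y" by (rule vec_eq_if_diff_zero[OF c])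
  qed
  have MS: "vec_coset (mat_range M) x \<subseteq> carrier_vec m" if "x \<in> carrier_vec m" for x
    using that mat_range_carrier[of M] M by (auto simp: vec_coset_def)
  have sm: "(S * M) *\<^sub>v c = S *\<^sub>v (M *\<^sub>v c)" if "c \<in> carrier_vec m" for c
    using assoc_mult_mat_vec[OF S M that] .
  have rSM: "mat_range (S * M) = mult_mat_vec S ` mat_range M"
    unfolding mat_range_def using M sm by (auto simp: image_image)
  have "vec_coset (mat_range (S * M)) (S *\<^sub>v x) = mult_mat_vec S ` vec_coset (mat_range M) x"
    if x: "x \<in> carrier_vec m" for x
  proof -
    have "S *\<^sub>v h + S *\<^sub>v x = S *\<^sub>v (h + x)" if "h \<in> mat_range M" for h
      using that mat_range_carrier[of M] M x mult_add_distrib_mat_vec[OF S, of h x] by auto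
    then show ?thesis unfolding vec_coset_def rSM image_image by (intro image_cong) auto
  qed
  then have "vec_coset (mat_range (S * M)) ` mat_range S
      = (\<lambda>C. mult_mat_vec S ` C) ` (vec_coset (mat_range M) ` carrier_vec m)"
    unfolding mat_range_def[of S] using S by (auto simp: image_image)
  moreover have "inj_on (\<lambda>C. mult_mat_vec S ` C) (vec_coset (mat_range M) ` carrier_vec m)"
    by (rule inj_on_subset[OF inj_on_image_Pow[OF injS]]) (use MS in auto)
  ultimately show ?thesis
    unfolding quotient_order_eq card_cosets_mat_range[OF M d, symmetric]
    by (simp add: card_image)
qed

section \<open>Gram determinants and covolumes\<close>

text \<open>The squared norm of the wedge product, kept in the ring of the entries so that integer
  and real matrices can be compared before any square root is taken.\<close>

definition gram :: "'a :: comm_ring_1 mat \<Rightarrow> 'a" where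
  "gram F = det (transpose_mat F * F)"

lemma wedge_norm_eq: "wedge_norm N w = sqrt (real_of_int (gram (mat_of_cols N w)))"
  by (simp add: wedge_norm_def gram_def Let_def)

text \<open>\<open>M\<close> is square, so its determinant splits off from both sides of the Gram
  matrix, while \<open>F\<close> may be rectangular.\<close>

lemma gram_mult:
  fixes F M :: "'a :: comm_ring_1 mat"
  assumes F: "F \<in> carrier_mat N m" and M: "M \<in> carrier_mat m m"
  shows "gram (F * M) = gram F * (det M)\<^sup>2"
proof -
  have Ft: "transpose_mat F \<in> carrier_mat m N" and Mt: "transpose_mat M \<in> carrier_mat m m"
    using F M by auto
  have G: "transpose_mat F * F \<in> carrier_mat m m" using F Ft by simp
  have "transpose_mat (F * M) * (F * M) = (transpose_mat M * transpose_mat F) * (F * M)"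
    using transpose_mult[OF F M] by simp
  also have "\<dots> = transpose_mat M * (transpose_mat F * (F * M))"
    by (rule assoc_mult_mat[OF Mt Ft]) (use F M in auto)
  also have "transpose_mat F * (F * M) = (transpose_mat F * F) * M"
    by (rule assoc_mult_mat[OF Ft F M, symmetric])
  finally have "gram (F * M) = det (transpose_mat M) * det ((transpose_mat F * F) * M)"
    unfolding gram_def using det_mult[OF Mt mult_carrier_mat[OF G M]] by simp
  then show ?thesis
    using det_mult[OF G M] det_transpose[OF M]
    by (simp add: gram_def power2_eq_square algebra_simps)
qed

text \<open>If F^T F v = 0 then the sum of the squares of the entries of F v is zero, and in an
  ordered ring this forces F v = 0.\<close>

lemma mat_inj_iff_gram:
  fixes F :: "'a :: linordered_idom mat"
  assumes F: "F \<in> carrier_mat N m"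
  shows "mat_inj F \<longleftrightarrow> gram F \<noteq> 0"
proof -
  have Ft: "transpose_mat F \<in> carrier_mat m N" using F by auto
  have G: "transpose_mat F * F \<in> carrier_mat m m" using F Ft by simp
  have "(transpose_mat F * F) *\<^sub>v v = 0\<^sub>v m \<longleftrightarrow> F *\<^sub>v v = 0\<^sub>v N" if v: "v \<in> carrier_vec m" for v
  proof
    have Fv: "F *\<^sub>v v \<in> carrier_vec N" using F v by simp
    have as: "(transpose_mat F * F) *\<^sub>v v = transpose_mat F *\<^sub>v (F *\<^sub>v v)"
      by (rule assoc_mult_mat_vec[OF Ft F v])
    {
      assume "(transpose_mat F * F) *\<^sub>v v = 0\<^sub>v m"
      then have "transpose_mat F *\<^sub>v (F *\<^sub>v v) = 0\<^sub>v m" using as by simp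
      then have "(transpose_mat F *\<^sub>v (F *\<^sub>v v)) \<bullet> v = 0" using v by simp
      then have "(F *\<^sub>v v) \<bullet> (F *\<^sub>v v) = 0"
        using transpose_vec_mult_scalar[OF F v Fv] by simp
      then have "(\<Sum>i=0..<N. (F *\<^sub>v v) $ i * (F *\<^sub>v v) $ i) = 0"
        using Fv F by (simp add: scalar_prod_def del: index_mult_mat_vec)
      then have "\<forall>i\<in>{0..<N}. (F *\<^sub>v v) $ i * (F *\<^sub>v v) $ i = 0"
        by (subst (asm) sum_nonneg_eq_0_iff) auto
      then show "F *\<^sub>v v = 0\<^sub>v N" using Fv
        F by (intro eq_vecI) (auto simp del: index_mult_mat_vec)
    }
    assume "F *\<^sub>v v = 0\<^sub>v N"
    then show "(transpose_mat F * F) *\<^sub>v v = 0\<^sub>v m" using as mult_mat_vec_zero[OF Ft] by simp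
  qed
  then show ?thesis
    unfolding mat_inj_def gram_def using det_0_iff_vec_prod_zero[OF G] F by auto
qed

lemma gram_of_int: "gram (map_mat real_of_int F) = real_of_int (gram F)"
proof -
  have "map_mat real_of_int (transpose_mat F * F)
      = map_mat real_of_int (transpose_mat F) * map_mat real_of_int F"
    by (rule of_int_hom.mat_hom_mult) (auto intro: carrier_matI)
  then show ?thesis
    unfolding gram_def by (simp flip: map_mat_transpose of_int_hom.hom_det)
qed

text \<open>Independence over the integers passes to the reals because the Gram determinant is the
  same number; no denominators have to be cleared.\<close>

lemma mat_inj_of_int:
  fixes F :: "int mat"
  assumes F: "F \<in> carrier_mat N m" and inj: "mat_inj F"
  shows "mat_inj (map_mat real_of_int F)"
proof -
  have "map_mat real_of_int F \<in> carrier_mat N m" using F by simp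
  then show ?thesis
    using mat_inj_iff_gram[of "map_mat real_of_int F" N m] mat_inj_iff_gram[OF F] inj
    by (simp add: gram_of_int)
qed

lemma mat_inj_distinct_cols:
  fixes F :: "'a :: idom mat"
  assumes F: "F \<in> carrier_mat N m" and inj: "mat_inj F"
  shows "distinct (cols F)"
proof -
  have "i = j" if ij: "i < m" "j < m" "col F i = col F j" for i j
  proof (rule ccontr)
    assume ne: "i \<noteq> j"
    have "F *\<^sub>v (unit_vec m i - unit_vec m j) = 0\<^sub>v N"
      using ij F by (simp add: mult_minus_distrib_mat_vec[OF F] mult_unit_vec_col[OF F])
    then have "unit_vec m i - unit_vec m j = (0\<^sub>v m :: 'a vec)"
      by (intro mat_injD[OF inj F]) auto
    then have "(unit_vec m i - unit_vec m j) $ i = (0\<^sub>v m :: 'a vec) $ i" by simp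
    then show False using ij ne by simp
  qed
  then show ?thesis using F by (auto simp: distinct_conv_nth)
qed

lemma int_subgroup_has_basis:
  assumes L: "int_subgroup N L"
  shows "\<exists>f. is_int_basis N L f"
proof -
  interpret idom_vec N "TYPE(int)" .
  obtain y where piv: "echelon_pivots N L y"
    and rng: "mat_range (mat_of_cols N (map y (filter (\<lambda>j. y j $ j \<noteq> 0) [0..<N]))) = L"
    by (rule echelon_basis_exists[OF L])
  note y = echelon_pivotsD[OF piv]
  have yc: "y j \<in> carrier_vec N" if "j < N" for j using int_subgroupD(1)[OF L] y(1) that by blast
  define f where "f = map y (filter (\<lambda>j. y j $ j \<noteq> 0) [0..<N])"
  have fc: "set f \<subseteq> carrier_vec N" using yc by (auto simp: f_def)
  have inj: "mat_inj (mat_of_cols N f)" unfolding f_def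
    by (rule echelon_mat_inj) (use y(2) yc in auto)
  have dist: "distinct f"
    using mat_inj_distinct_cols[OF mat_of_cols_carrier(1) inj] fc by simp
  show ?thesis
    unfolding is_int_basis_def int_span_def
    using fc dist inj lin_indpt_iff_mat_inj[OF fc dist] span_eq_mat_range[OF fc] rng
    by (intro exI[of _ f]) (auto simp: f_def[symmetric])
qed

text \<open>The columns of \<open>F\<close> are the very basis chosen by \<open>SOME\<close> in
  \<open>covol\<close>, so its Gram determinant gives the covolume by definition.\<close>

lemma int_subgroup_basis:
  assumes L: "int_subgroup N L"
  obtains F m where "F \<in> carrier_mat N m" "mat_inj F" "mat_range F = L"
    "covol N L = sqrt (real_of_int (gram F))"
proof -
  interpret idom_vec N "TYPE(int)" .
  define f where "f = (SOME f. is_int_basis N L f)"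
  have f: "is_int_basis N L f"
    unfolding f_def by (rule someI_ex) (rule int_subgroup_has_basis[OF L])
  then have fc: "set f \<subseteq> carrier_vec N" and dist: "distinct f" by (auto simp: is_int_basis_def)
  have "mat_inj (mat_of_cols N f)" "mat_range (mat_of_cols N f) = L"
    using f lin_indpt_iff_mat_inj[OF fc dist] span_eq_mat_range[OF fc]
    by (auto simp: is_int_basis_def int_span_def)
  then show ?thesis
    using that[OF mat_of_cols_carrier(1)[of N f]] by (simp add: covol_def wedge_norm_eq f_def)
qed

section \<open>Spans and ranks of families as matrix ranges\<close>

lemma int_span_eq_mat_range:
  assumes "set w \<subseteq> carrier_vec N"
  shows "int_span N w = mat_range (mat_of_cols N w)"
proof -
  interpret idom_vec N "TYPE(int)" .
  show ?thesis unfolding int_span_def by (rule span_eq_mat_range[OF assms])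
qed

lemma real_span_eq_mat_range:
  assumes "set w \<subseteq> carrier_vec N"
  shows "real_span N w = mat_range (map_mat real_of_int (mat_of_cols N w))"
proof -
  interpret idom_vec N "TYPE(real)" .
  have "set (map (map_vec real_of_int) w) \<subseteq> carrier_vec N" using assms by auto
  then show ?thesis
    unfolding real_span_def using span_eq_mat_range mat_of_cols_map[OF assms] by metis
qed

lemma rank_eq_dim_col:
  fixes X F :: "'a :: field mat"
  assumes X: "X \<in> carrier_mat N n" and F: "F \<in> carrier_mat N m" and inj: "mat_inj F"
    and eq: "mat_range X = mat_range F"
  shows "vec_space.rank N X = m"
proof -
  interpret vec_space "TYPE('a)" N .
  have cX: "set (cols X) \<subseteq> carrier_vec N" and cF: "set (cols F) \<subseteq> carrier_vec N"
    using X F cols_dim by blast+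
  have m: "mat_of_cols N (cols X) = X" "mat_of_cols N (cols F) = F" using X F by auto
  have "span (set (cols X)) = span (set (cols F))"
    using span_eq_mat_range[OF cX] span_eq_mat_range[OF cF] m eq by simp
  then have "rank X = rank F" by (simp add: rank_def)
  also have "\<dots> = m"
  proof (rule lin_indpt_full_rank[OF F])
    show dist: "distinct (cols F)" by (rule mat_inj_distinct_cols[OF F inj])
    show "lin_indpt (set (cols F))" using lin_indpt_iff_mat_inj[OF cF dist] m inj by simp
  qed
  finally show ?thesis .
qed

section \<open>Complementary minors\<close>

text \<open>A block matrix with two lower blocks of height zero, so that the multiplication rule for
  four blocks also covers the pairing with \<open>append_rows\<close>.\<close>

definition hcat :: "'a :: zero mat \<Rightarrow> 'a mat \<Rightarrow> 'a mat" where
  "hcat X Y = four_block_mat X Y (0\<^sub>m 0 (dim_col X)) (0\<^sub>m 0 (dim_col Y))"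

lemma hcat_carrier:
  "X \<in> carrier_mat n r \<Longrightarrow> Y \<in> carrier_mat n s \<Longrightarrow> hcat X Y \<in> carrier_mat n (r + s)"
  by (auto simp: hcat_def)

lemma append_rows_mult_hcat:
  fixes X1 :: "'a :: comm_ring_1 mat"
  assumes X: "X1 \<in> carrier_mat r n" "X2 \<in> carrier_mat s n"
    and Y: "Y1 \<in> carrier_mat n r'" "Y2 \<in> carrier_mat n s'"
  shows "(X1 @\<^sub>r X2) * hcat Y1 Y2 = four_block_mat (X1 * Y1) (X1 * Y2) (X2 * Y1) (X2 * Y2)"
proof -
  have z: "0\<^sub>m a 0 * 0\<^sub>m 0 b = (0\<^sub>m a b :: 'a mat)" for a b by (intro eq_matI) auto
  have "(X1 @\<^sub>r X2) * hcat Y1 Y2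
      = four_block_mat X1 (0\<^sub>m r 0) X2 (0\<^sub>m s 0) * four_block_mat Y1 Y2 (0\<^sub>m 0 r') (0\<^sub>m 0 s')"
    using X Y by (simp add: append_rows_def hcat_def)
  also have "\<dots> = four_block_mat (X1 * Y1) (X1 * Y2) (X2 * Y1) (X2 * Y2)"
    by (subst mult_four_block_mat[where ?nr1.0 = r and ?n1.0 = n and ?n2.0 = 0 and ?nr2.0 = s and ?nc1.0 = r' and ?nc2.0 = s'])
      (use X Y in \<open>simp_all add: z\<close>)
  finally show ?thesis .
qed

lemma hcat_mult_append_rows:
  fixes X1 :: "'a :: comm_ring_1 mat"
  assumes X: "X1 \<in> carrier_mat n r" "X2 \<in> carrier_mat n s"
    and Y: "Y1 \<in> carrier_mat r m" "Y2 \<in> carrier_mat s m"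
  shows "hcat X1 X2 * (Y1 @\<^sub>r Y2) = X1 * Y1 + X2 * Y2"
proof (rule eq_matI)
  fix i j assume "i < dim_row (X1 * Y1 + X2 * Y2)" "j < dim_col (X1 * Y1 + X2 * Y2)"
  then have i: "i < n" and j: "j < m" using X Y by auto
  have "(hcat X1 X2 * (Y1 @\<^sub>r Y2)) $$ (i,j)
      = (row X1 i @\<^sub>v row X2 i) \<bullet> (col Y1 j @\<^sub>v col Y2 j)"
  proof -
    have "row (hcat X1 X2) i = row X1 i @\<^sub>v row X2 i"
      unfolding hcat_def using X i by (intro row_four_block_mat(1)) auto
    moreover have "col (Y1 @\<^sub>r Y2) j = col Y1 j @\<^sub>v col Y2 j"
      unfolding append_rows_def using Y j by (intro col_four_block_mat(1)) auto
    ultimately show ?thesis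
      using i j hcat_carrier[OF X] carrier_append_rows[OF Y] by simp
  qed
  also have "\<dots> = row X1 i \<bullet> col Y1 j + row X2 i \<bullet> col Y2 j"
    by (rule scalar_prod_append[where ?n1.0 = r and ?n2.0 = s]) (use X Y i j in auto)
  finally show "(hcat X1 X2 * (Y1 @\<^sub>r Y2)) $$ (i,j) = (X1 * Y1 + X2 * Y2) $$ (i,j)"
    using i j X Y by simp
qed (use X Y in \<open>auto simp: hcat_def append_rows_def\<close>)

text \<open>Multiplication by this matrix on the right selects columns, which turns a minor into the
  determinant of a product.\<close>

definition select_mat :: "nat \<Rightarrow> nat list \<Rightarrow> 'a :: comm_ring_1 mat" where
  "select_mat n is = mat_of_cols n (map (unit_vec n) is)"

lemma select_mat_carrier [simp]: "select_mat n is \<in> carrier_mat n (length is)"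
  unfolding select_mat_def by (rule carrier_matI) simp_all

lemma mult_select_mat:
  fixes A :: "'a :: comm_ring_1 mat"
  assumes A: "A \<in> carrier_mat r n" and "set is \<subseteq> {..<n}"
  shows "A * select_mat n is = mat_of_cols r (map (col A) is)"
proof (rule mat_eq_colI)
  show "A * select_mat n is \<in> carrier_mat r (length is)" using A by simp
  show "mat_of_cols r (map (col A) is) \<in> carrier_mat r (length is)"
    by (rule carrier_matI) simp_all
  fix j assume j: "j < length is"
  then have n: "is ! j < n" using assms(2) nth_mem by blast
  have "col (A * select_mat n is) j = A *\<^sub>v col (select_mat n is) j"
    by (rule col_mult2[OF A select_mat_carrier j])
  also have "col (select_mat n is) j = unit_vec n (is ! j)"
    unfolding select_mat_def using j by simp
  also have "A *\<^sub>v unit_vec n (is ! j) = col A (is ! j)" by (rule mult_unit_vec_col[OF A n])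
  also have "\<dots> = col (mat_of_cols r (map (col A) is)) j"
    using j carrier_matD(1)[OF A] col_dim[of A "is ! j"]
    by (subst col_mat_of_cols) (auto intro: carrier_vecI)
  finally show "col (A * select_mat n is) j = col (mat_of_cols r (map (col A) is)) j" .
qed

lemma transpose_select_mat_mult:
  assumes "set is \<subseteq> {..<n}" "set js \<subseteq> {..<n}"
  shows "transpose_mat (select_mat n is) * select_mat n js
    = (mat (length is) (length js) (\<lambda>(k,l). if is ! k = js ! l then 1 else 0) :: 'a :: comm_ring_1 mat)"
proof (rule eq_matI)
  fix k l assume "k < dim_row (mat (length is) (length js) (\<lambda>(k,l). if is ! k = js ! l then 1 else 0 :: 'a))"
    "l < dim_col (mat (length is) (length js) (\<lambda>(k,l). if is ! k = js ! l then 1 else 0 :: 'a))"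
  then have k: "k < length is" and l: "l < length js" by auto
  then have n: "is ! k < n" "js ! l < n" using assms nth_mem by blast+
  have "(transpose_mat (select_mat n is) * select_mat n js) $$ (k,l)
      = col (select_mat n is) k \<bullet> (col (select_mat n js) l :: 'a vec)"
    using k l by (simp add: carrier_matD[OF select_mat_carrier])
  also have "\<dots> = unit_vec n (is ! k) \<bullet> (unit_vec n (js ! l) :: 'a vec)"
    unfolding select_mat_def using k l by simp
  also have "\<dots> = (if is ! k = js ! l then 1 else 0)" using n by simp
  finally show "(transpose_mat (select_mat n is) * select_mat n js) $$ (k,l)
     = mat (length is) (length js) (\<lambda>(k,l). if is ! k = js ! l then 1 else 0 :: 'a) $$ (k,l)"
    using k l by simp
qed (simp_all add: carrier_matD[OF select_mat_carrier])

lemma complementary_minors: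
  fixes A B :: "int mat"
  assumes A: "A \<in> carrier_mat r n" "A' \<in> carrier_mat n r" "A * A' = 1\<^sub>m r"
    and B: "B \<in> carrier_mat s n" "B' \<in> carrier_mat n s" "B * B' = 1\<^sub>m s"
    and orth: "A * transpose_mat B = 0\<^sub>m r s" and n: "n = r + s"
    and "is": "distinct is" "set is \<subseteq> {..<n}" "length is = r"
    and js: "distinct js" "set js \<subseteq> {..<n}" "length js = s"
    and disj: "set is \<inter> set js = {}"
  shows "\<bar>det (mat_of_cols r (map (col A) is))\<bar> = \<bar>det (mat_of_cols s (map (col B) js))\<bar>"
proof -
  let ?Bt = "transpose_mat B" and ?Bt' = "transpose_mat B'"
  have Bt: "?Bt \<in> carrier_mat n s" "?Bt' \<in> carrier_mat s n" using B by auto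
  have BB: "?Bt' * ?Bt = 1\<^sub>m s" using transpose_mult[OF B(1,2)] B(3) by simp
  define EI where "EI = (select_mat n is :: int mat)"
  define EJ where "EJ = (select_mat n js :: int mat)"
  have E: "EI \<in> carrier_mat n r" "EJ \<in> carrier_mat n s"
    unfolding EI_def EJ_def using "is"(3) js(3) select_mat_carrier by metis+
  have Et: "transpose_mat EI \<in> carrier_mat r n" "transpose_mat EJ \<in> carrier_mat s n" using E by auto
  have II: "transpose_mat EI * EI = 1\<^sub>m r" "transpose_mat EJ * EJ = 1\<^sub>m s"
    unfolding EI_def EJ_def transpose_select_mat_mult[OF "is"(2) "is"(2)] transpose_select_mat_mult[OF js(2) js(2)]
    using "is" js by (auto intro!: eq_matI simp: nth_eq_iff_index_eq)
  have IJ: "transpose_mat EI * EJ = 0\<^sub>m r s" "transpose_mat EJ * EI = 0\<^sub>m s r"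
    unfolding EI_def EJ_def transpose_select_mat_mult[OF "is"(2) js(2)] transpose_select_mat_mult[OF js(2) "is"(2)]
    using disj "is"(3) js(3) by (auto intro!: eq_matI) (metis disjoint_iff nth_mem)+
  define N where "N = A @\<^sub>r ?Bt'"
  have N: "N \<in> carrier_mat n n" unfolding N_def n using A Bt n by auto
  define Q where "Q = hcat EI ?Bt"
  have Q: "Q \<in> carrier_mat n n" unfolding Q_def using hcat_carrier[OF E(1) Bt(1)] n by simp
  \<comment> \<open>The lower left block may be nonzero; the zero block given by \<open>orth\<close>
    is enough to make the product unitriangular.\<close>
  have "N * hcat A' ?Bt = four_block_mat (1\<^sub>m r) (0\<^sub>m r s) (?Bt' * A') (1\<^sub>m s)"
    unfolding N_def append_rows_mult_hcat[OF A(1) Bt(2) A(2) Bt(1)] using A B BB orth by simp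
  then have "det (N * hcat A' ?Bt) = det (1\<^sub>m r :: int mat) * det (1\<^sub>m s :: int mat)"
    using det_four_block_mat_upper_right_zero[of "1\<^sub>m r :: int mat" r "0\<^sub>m r s" s "?Bt' * A'" "1\<^sub>m s"]
      A Bt by simp
  then have "det N * det (hcat A' ?Bt) = 1"
    using det_mult[OF N, of "hcat A' ?Bt"] hcat_carrier[OF A(2) Bt(1)] n by simp
  then have detN: "\<bar>det N\<bar> = 1" using abs_zmult_eq_1 by (metis abs_one)
  \<comment> \<open>A permutation matrix. Its determinant is found up to sign from its product with
    its own transpose, so the sign of the shuffle never has to be computed.\<close>
  define Pt where "Pt = transpose_mat EI @\<^sub>r transpose_mat EJ"
  have Pt: "Pt \<in> carrier_mat n n" unfolding Pt_def n using Et n by auto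
  have "Pt * hcat EI EJ = four_block_mat (1\<^sub>m r) (0\<^sub>m r s) (0\<^sub>m s r) (1\<^sub>m s)"
    unfolding Pt_def append_rows_mult_hcat[OF Et E] by (simp add: II IJ)
  then have "Pt * hcat EI EJ = 1\<^sub>m n" using n by simp
  then have detP: "\<bar>det Pt\<bar> = 1"
    by (rule int_det_factor_one[OF Pt, rotated]) (use hcat_carrier[OF E] n in simp)
  have "N * Q = four_block_mat (A * EI) (0\<^sub>m r s) (?Bt' * EI) (1\<^sub>m s)"
    unfolding N_def Q_def append_rows_mult_hcat[OF A(1) Bt(2) E(1) Bt(1)] by (simp add: BB orth)
  then have "det (N * Q) = det (A * EI)"
    using det_four_block_mat_upper_right_zero[of "A * EI" r "0\<^sub>m r s" s "?Bt' * EI" "1\<^sub>m s"]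
      A Bt E by simp
  then have "\<bar>det (A * EI)\<bar> = \<bar>det Q\<bar>" using det_mult[OF N Q] detN by (metis abs_mult mult_1)
  moreover have "Pt * Q = four_block_mat (1\<^sub>m r) (transpose_mat EI * ?Bt) (0\<^sub>m s r) (transpose_mat EJ * ?Bt)"
    unfolding Pt_def Q_def append_rows_mult_hcat[OF Et E(1) Bt(1)] by (simp add: II IJ)
  then have "det (Pt * Q) = det (transpose_mat EJ * ?Bt)"
    using det_four_block_mat_lower_left_zero[of "1\<^sub>m r :: int mat" r "transpose_mat EI * ?Bt" s "0\<^sub>m s r"
        "transpose_mat EJ * ?Bt"] Bt Et by simp
  then have "\<bar>det Q\<bar> = \<bar>det (transpose_mat EJ * ?Bt)\<bar>"
    using det_mult[OF Pt Q] detP by (metis abs_mult mult_1)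
  moreover have "transpose_mat EJ * ?Bt = transpose_mat (B * EJ)"
    using transpose_mult[OF B(1) E(2)] by simp
  moreover have "det (transpose_mat (B * EJ)) = det (B * EJ)"
    by (rule det_transpose) (use B E in auto)
  ultimately show ?thesis
    using mult_select_mat[OF A(1) "is"(2)] mult_select_mat[OF B(1) js(2)]
    by (simp add: EI_def EJ_def)
qed

text \<open>The real vector \<open>x - A' A x\<close> lies in the kernel of \<open>A\<close>, hence in the range of \<open>B\<^sup>T\<close>.\<close>

lemma complementary_rank:
  fixes A B :: "int mat"
  assumes A: "A \<in> carrier_mat r n" "A' \<in> carrier_mat n r" "A * A' = 1\<^sub>m r"
    and B: "B \<in> carrier_mat s n" "B' \<in> carrier_mat n s" "B * B' = 1\<^sub>m s"
    and orth: "A * transpose_mat B = 0\<^sub>m r s"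
    and ker: "\<And>x. x \<in> carrier_vec n \<Longrightarrow> map_mat real_of_int A *\<^sub>v x = 0\<^sub>v r \<Longrightarrow>
      x \<in> mat_range (map_mat real_of_int (transpose_mat B))"
  shows "n = r + s"
proof (rule antisym)
  let ?Bt = "transpose_mat B" and ?Bt' = "transpose_mat B'"
  have Bt: "?Bt \<in> carrier_mat n s" "?Bt' \<in> carrier_mat s n" using B by auto
  have BB: "?Bt' * ?Bt = 1\<^sub>m s" using transpose_mult[OF B(1,2)] B(3) by simp
  \<comment> \<open>\<open>C\<close> corrects \<open>A'\<close> by a combination of the columns of
    B^T, so that the product of block matrices becomes the identity itself, as
    \<open>one_mat_factor_le\<close> requires.\<close>
  define C where "C = ?Bt' * A'"
  have C: "C \<in> carrier_mat s r" using A Bt by (auto simp: C_def)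
  have BC: "?Bt * C \<in> carrier_mat n r" using C Bt by simp
  define A'' where "A'' = A' - ?Bt * C"
  have A'': "A'' \<in> carrier_mat n r" unfolding A''_def by (rule minus_carrier_mat[OF BC])
  have "A * A'' = A * A' - A * (?Bt * C)"
    unfolding A''_def by (rule mult_minus_distrib_mat[OF A(1,2) BC])
  also have "A * (?Bt * C) = 0\<^sub>m r r"
    using assoc_mult_mat[OF A(1) Bt(1) C] orth C by simp
  finally have AA: "A * A'' = 1\<^sub>m r" using A(3) by (auto intro!: eq_matI)
  have "?Bt' * A'' = ?Bt' * A' - ?Bt' * (?Bt * C)"
    unfolding A''_def by (rule mult_minus_distrib_mat[OF Bt(2) A(2) BC])
  also have "?Bt' * (?Bt * C) = C"
    using assoc_mult_mat[OF Bt(2,1) C] BB C by simp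
  finally have BA: "?Bt' * A'' = 0\<^sub>m s r" using C by (auto intro!: eq_matI simp: C_def[symmetric])
  have "(A @\<^sub>r ?Bt') * hcat A'' ?Bt = four_block_mat (1\<^sub>m r) (0\<^sub>m r s) (0\<^sub>m s r) (1\<^sub>m s)"
    unfolding append_rows_mult_hcat[OF A(1) Bt(2) A'' Bt(1)] by (simp add: AA BA BB orth)
  then have "(A @\<^sub>r ?Bt') * hcat A'' ?Bt = 1\<^sub>m (r + s)" by simp
  then show "r + s \<le> n"
    by (rule one_mat_factor_le[rotated 2]) (use A Bt hcat_carrier[OF A'' Bt(1)] in auto)
next
  let ?R = "map_mat real_of_int"
  have R: "?R A \<in> carrier_mat r n" "?R A' \<in> carrier_mat n r" "?R (transpose_mat B) \<in> carrier_mat n s"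
    using A B by auto
  have AA: "?R A * ?R A' = 1\<^sub>m r"
    using of_int_hom.mat_hom_mult[OF A(1,2), where 'a = real] A(3) by (simp add: of_int_hom.mat_hom_one)
  \<comment> \<open>A projection with A P = A; the columns of 1 - P therefore lie in the kernel of
    \<open>A\<close>.\<close>
  define P where "P = ?R A' * ?R A"
  have P: "P \<in> carrier_mat n n" using R by (simp add: P_def)
  define D where "D = 1\<^sub>m n - P"
  have D: "D \<in> carrier_mat n n" unfolding D_def by (rule minus_carrier_mat[OF P])
  have "?R A * D = ?R A * 1\<^sub>m n - ?R A * P"
    unfolding D_def by (rule mult_minus_distrib_mat[OF R(1) _ P]) simp
  also have "?R A * P = ?R A"
    unfolding P_def using assoc_mult_mat[OF R(1,2,1)] AA R by simp
  finally have AD: "?R A * D = 0\<^sub>m r n" using R by (auto intro!: eq_matI)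
  have "col D j \<in> mat_range (?R (transpose_mat B))" if j: "j < n" for j
  proof (rule ker)
    show "col D j \<in> carrier_vec n" using D j by auto
    show "?R A *\<^sub>v col D j = 0\<^sub>v r"
      using col_mult2[OF R(1) D j] AD j by (auto intro!: eq_vecI)
  qed
  then obtain Z where Z: "Z \<in> carrier_mat s n" "D = ?R (transpose_mat B) * Z"
    by (rule mat_range_subset_factor[OF D R(3)])
  \<comment> \<open>The identity of R^n factors through a space of dimension r + s.\<close>
  have "hcat (?R A') (?R (transpose_mat B)) * (?R A @\<^sub>r Z) = P + D"
    unfolding hcat_mult_append_rows[OF R(2,3,1) Z(1)] by (simp add: P_def Z)
  also have "\<dots> = 1\<^sub>m n" using P by (auto intro!: eq_matI simp: D_def)
  finally show "n \<le> r + s"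
    by (rule one_mat_factor_le[rotated 2])
      (use hcat_carrier[OF R(2,3)] carrier_append_rows[OF R(1) Z(1)] in auto)
qed

section \<open>Lattices generated by a family of vectors\<close>

lemma int_subgroup_sat_span:
  assumes w: "set w \<subseteq> carrier_vec N"
  shows "int_subgroup N (sat_span N w)"
proof -
  let ?W = "map_mat real_of_int (mat_of_cols N w)"
  have W: "?W \<in> carrier_mat N (length w)" by (rule carrier_matI) simp_all
  have "map_vec real_of_int (0\<^sub>v N) = ?W *\<^sub>v 0\<^sub>v (length w)"
    using mult_mat_vec_zero[OF W] by auto
  then have zero: "0\<^sub>v N \<in> sat_span N w"
    unfolding sat_span_def real_span_eq_mat_range[OF w] using mat_rangeI[OF W] by auto
  have "x - y \<in> sat_span N w" if xy: "x \<in> sat_span N w" "y \<in> sat_span N w" for x y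
  proof -
    obtain a b where ab: "a \<in> carrier_vec (length w)" "map_vec real_of_int x = ?W *\<^sub>v a"
        "b \<in> carrier_vec (length w)" "map_vec real_of_int y = ?W *\<^sub>v b"
      and c: "x \<in> carrier_vec N" "y \<in> carrier_vec N"
      using xy unfolding sat_span_def real_span_eq_mat_range[OF w] mat_range_def by auto
    have "map_vec real_of_int (x - y) = map_vec real_of_int x - map_vec real_of_int y"
      using c by (intro eq_vecI) auto
    then have "map_vec real_of_int (x - y) = ?W *\<^sub>v (a - b)"
      using ab by (simp add: mult_minus_distrib_mat_vec[OF W])
    then show ?thesis
      using c ab mat_rangeI[OF W, of "a - b"]
      unfolding sat_span_def real_span_eq_mat_range[OF w] by auto
  qed
  then show ?thesis using zero by (auto simp: int_subgroup_def sat_span_def)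
qed

lemma int_span_subset_sat_span:
  assumes w: "set w \<subseteq> carrier_vec N"
  shows "int_span N w \<subseteq> sat_span N w"
proof
  let ?W = "mat_of_cols N w"
  have W: "?W \<in> carrier_mat N (length w)" by simp
  fix z assume "z \<in> int_span N w"
  then obtain c where c: "c \<in> carrier_vec (length w)" "z = ?W *\<^sub>v c"
    unfolding int_span_eq_mat_range[OF w] by (rule mat_rangeE[OF _ W])
  have zc: "z \<in> carrier_vec N"
    unfolding c(2) by (rule mult_mat_vec_carrier[OF W c(1)])
  have "map_vec real_of_int z = map_mat real_of_int ?W *\<^sub>v map_vec real_of_int c"
    using of_int_hom.mult_mat_vec_hom[OF W c(1), where 'a = real] c by simp
  then show "z \<in> sat_span N w"
    unfolding sat_span_def real_span_eq_mat_range[OF w]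
    using c(1) zc W mat_rangeI[of "map_mat real_of_int ?W" N "length w" "map_vec real_of_int c"] by auto
qed

text \<open>\<open>F\<close> and the matrix of the family have the same integer column span, so each
  factors through the other, and cancelling \<open>F\<close> in F A A' = F shows that
  \<open>A'\<close> is a right inverse of \<open>A\<close>.\<close>

lemma int_span_basis:
  assumes w: "set w \<subseteq> carrier_vec N"
  obtains F A A' m where "F \<in> carrier_mat N m" "mat_inj F" "mat_range F = int_span N w"
    "A \<in> carrier_mat m (length w)" "A' \<in> carrier_mat (length w) m"
    "mat_of_cols N w = F * A" "F = mat_of_cols N w * A'" "A * A' = 1\<^sub>m m"
    "covol N (int_span N w) = sqrt (real_of_int (gram F))"
proof -
  let ?W = "mat_of_cols N w"
  have W: "?W \<in> carrier_mat N (length w)" by simp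
  have "int_subgroup N (int_span N w)"
    unfolding int_span_eq_mat_range[OF w] by (rule int_subgroup_mat_range[OF W])
  then obtain F m where F: "F \<in> carrier_mat N m" "mat_inj F" "mat_range F = int_span N w"
    "covol N (int_span N w) = sqrt (real_of_int (gram F))"
    by (rule int_subgroup_basis)
  obtain A where A: "A \<in> carrier_mat m (length w)" "?W = F * A"
    by (rule mat_range_subset_factor[OF W F(1)])
      (use col_in_mat_range[OF W] F(3) in \<open>auto simp: int_span_eq_mat_range[OF w]\<close>)
  obtain A' where A': "A' \<in> carrier_mat (length w) m" "F = ?W * A'"
    by (rule mat_range_subset_factor[OF F(1) W])
      (use col_in_mat_range[OF F(1)] F(3) in \<open>auto simp: int_span_eq_mat_range[OF w]\<close>)
  have "F * (A * A') = F * 1\<^sub>m m"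
    using assoc_mult_mat[OF F(1) A(1) A'(1)] right_mult_one_mat[OF F(1)] A(2) A'(2) by metis
  then have "A * A' = 1\<^sub>m m"
    by (rule mat_inj_cancel[OF F(2,1), rotated 2]) (use A A' in auto)
  then show ?thesis using that F A A' by blast
qed

text \<open>The two factorisations survive the passage to the reals, so the real rank is the number
  of lattice basis vectors.\<close>

lemma family_rank_eq:
  assumes w: "set w \<subseteq> carrier_vec N"
    and F: "F \<in> carrier_mat N m" "mat_inj F"
    and A: "A \<in> carrier_mat m (length w)" "A' \<in> carrier_mat (length w) m"
    and eq: "mat_of_cols N w = F * A" "F = mat_of_cols N w * A'"
  shows "family_rank N w = m"
proof -
  let ?R = "map_mat real_of_int" and ?W = "mat_of_cols N w"
  have W: "?W \<in> carrier_mat N (length w)" by simp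
  have R: "?R F \<in> carrier_mat N m" "?R ?W \<in> carrier_mat N (length w)"
    "?R A \<in> carrier_mat m (length w)" "?R A' \<in> carrier_mat (length w) m" using F W A by auto
  have "?R ?W = ?R F * ?R A"
    using of_int_hom.mat_hom_mult[OF F(1) A(1), where 'a = real] eq(1) by simp
  moreover have "?R F = ?R ?W * ?R A'"
    using of_int_hom.mat_hom_mult[OF W A(2), where 'a = real] eq(2) by simp
  ultimately have "mat_range (?R ?W) = mat_range (?R F)"
    using mat_range_mult_subset[OF R(1,3)] mat_range_mult_subset[OF R(2,4)] by auto
  then show ?thesis
    unfolding family_rank_def by (rule rank_eq_dim_col[OF R(2,1) mat_inj_of_int[OF F]])
qed

text \<open>Bases of the generated lattice and of its saturation span the same real space. The
  integer matrix \<open>M\<close> between them is thus square and invertible over the reals, and its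
  absolute determinant is both the ratio of covolumes and the index.\<close>

lemma covol_ratio:
  assumes w: "set w \<subseteq> carrier_vec N"
  shows "covol N (int_span N w) \<noteq> 0" "covol N (sat_span N w) \<noteq> 0"
    "covol N (int_span N w) / covol N (sat_span N w)
       = real (quotient_order N (sat_span N w) (int_span N w))"
proof -
  let ?R = "map_mat real_of_int" and ?W = "mat_of_cols N w"
  have W: "?W \<in> carrier_mat N (length w)" by simp
  obtain F A A' m where F: "F \<in> carrier_mat N m" "mat_inj F" "mat_range F = int_span N w"
    and A: "A \<in> carrier_mat m (length w)" "?W = F * A"
    and cF: "covol N (int_span N w) = sqrt (real_of_int (gram F))"
    by (rule int_span_basis[OF w])
  obtain S m' where S: "S \<in> carrier_mat N m'" "mat_inj S" "mat_range S = sat_span N w"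
    and cS: "covol N (sat_span N w) = sqrt (real_of_int (gram S))"
    by (rule int_subgroup_basis[OF int_subgroup_sat_span[OF w]])
  obtain M where M: "M \<in> carrier_mat m' m" "F = S * M"
    by (rule mat_range_subset_factor[OF F(1) S(1)])
      (use col_in_mat_range[OF F(1)] F(3) S(3) int_span_subset_sat_span[OF w] in auto)
  have R: "?R F \<in> carrier_mat N m" "?R ?W \<in> carrier_mat N (length w)"
    "?R A \<in> carrier_mat m (length w)" "?R S \<in> carrier_mat N m'" "?R M \<in> carrier_mat m' m"
    using F W A S M by auto
  have RW: "?R ?W = ?R F * ?R A"
    using of_int_hom.mat_hom_mult[OF F(1) A(1), where 'a = real] A(2) by simp
  have RF: "?R F = ?R S * ?R M"
    using of_int_hom.mat_hom_mult[OF S(1) M(1), where 'a = real] M(2) by simp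
  have "col (?R S) j \<in> mat_range (?R F)" if j: "j < m'" for j
  proof -
    have "col S j \<in> sat_span N w" using col_in_mat_range[OF S(1) j] S(3) by simp
    then have "map_vec real_of_int (col S j) \<in> mat_range (?R ?W)"
      by (simp add: sat_span_def real_span_eq_mat_range[OF w])
    moreover have "col (?R S) j = map_vec real_of_int (col S j)" using S(1) j by auto
    ultimately show ?thesis using mat_range_mult_subset[OF R(1,3)] RW by auto
  qed
  \<comment> \<open>\<open>X\<close> is real: it inverts \<open>M\<close> over the reals and has
    integer entries only if the two lattices coincide.\<close>
  then obtain X where X: "X \<in> carrier_mat m m'" "?R S = ?R F * X"
    by (rule mat_range_subset_factor[OF R(4,1)])
  have "?R F * (X * ?R M) = ?R F * 1\<^sub>m m"
    using assoc_mult_mat[OF R(1) X(1) R(5)] right_mult_one_mat[OF R(1)] X(2) RF by metis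
  then have "X * ?R M = 1\<^sub>m m"
    by (rule mat_inj_cancel[OF mat_inj_of_int[OF F(1,2)] R(1), rotated 2]) (use X R in auto)
  then have "m \<le> m'" by (rule one_mat_factor_le[OF X(1) R(5)])
  have "?R S * (?R M * X) = ?R S * 1\<^sub>m m'"
    using assoc_mult_mat[OF R(4,5) X(1)] right_mult_one_mat[OF R(4)] X(2) RF by metis
  then have MX: "?R M * X = 1\<^sub>m m'"
    by (rule mat_inj_cancel[OF mat_inj_of_int[OF S(1,2)] R(4), rotated 2]) (use X R in auto)
  then have "m' \<le> m" by (rule one_mat_factor_le[OF R(5) X(1)])
  with \<open>m \<le> m'\<close> have m: "m' = m" by simp
  note M' = M(1)[unfolded m] and S' = S(1)[unfolded m]
  have "det (?R M) * det X = 1"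
    using det_mult[OF R(5)[unfolded m] X(1)[unfolded m]] MX m by simp
  then have d: "det M \<noteq> 0" using of_int_hom.hom_det[of M, where 'a = real] by auto
  have gS: "gram S \<noteq> 0" using mat_inj_iff_gram[OF S(1)] S(2) by simp
  have gF: "gram F = gram S * (det M)\<^sup>2" unfolding M(2) by (rule gram_mult[OF S' M'])
  show "covol N (int_span N w) \<noteq> 0" "covol N (sat_span N w) \<noteq> 0"
    unfolding cF cS gF using gS d by auto
  have "covol N (int_span N w) / covol N (sat_span N w) = \<bar>real_of_int (det M)\<bar>"
    unfolding cF cS gF using gS by (simp add: real_sqrt_mult)
  also have "\<dots> = real (nat \<bar>det M\<bar>)" by simp
  also have "nat \<bar>det M\<bar> = quotient_order N (sat_span N w) (int_span N w)"
    using quotient_order_mat_range[OF S' S(2) M' d] S(3) F(3) M(2) by simp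
  finally show "covol N (int_span N w) / covol N (sat_span N w)
       = real (quotient_order N (sat_span N w) (int_span N w))" .
qed

lemma length_nths_upt:
  assumes "I \<subseteq> {..<n}"
  shows "length (nths [0..<n] I) = card I"
proof -
  have "{i. i < length [0..<n] \<and> i \<in> I} = I" using assms by auto
  then show ?thesis by (simp add: length_nths)
qed

lemma set_nths_upt:
  assumes "I \<subseteq> {..<n}"
  shows "set (nths [0..<n] I) = I"
  using assms by (force simp: set_nths)

text \<open>Selecting the columns of F A amounts to multiplying \<open>F\<close> by a square matrix
  of selected columns of \<open>A\<close>, to which \<open>gram_mult\<close> applies.\<close>

lemma wedge_norm_nths:
  assumes w: "set w \<subseteq> carrier_vec N"
    and F: "F \<in> carrier_mat N m" and A: "A \<in> carrier_mat m (length w)"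
    and eq: "mat_of_cols N w = F * A"
    and I: "I \<subseteq> {..<length w}" "card I = m"
  shows "wedge_norm N (nths w I) = sqrt (real_of_int (gram F)) *
    \<bar>real_of_int (det (mat_of_cols m (map (col A) (nths [0..<length w] I))))\<bar>"
proof -
  let ?is = "nths [0..<length w] I" and ?W = "mat_of_cols N w"
  let ?D = "mat_of_cols m (map (col A) ?is)"
  have W: "?W \<in> carrier_mat N (length w)" by simp
  have "is": "set ?is \<subseteq> {..<length w}" "length ?is = m"
    using I set_nths_upt length_nths_upt by auto
  have "w = map (col ?W) [0..<length w]"
    using w by (intro nth_equalityI) (auto simp: col_mat_of_cols subset_iff)
  then have "nths w I = map (col ?W) ?is" by (metis nths_map)
  then have "mat_of_cols N (nths w I) = ?W * select_mat (length w) ?is"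
    using mult_select_mat[OF W "is"(1)] by simp
  also have "\<dots> = F * (A * select_mat (length w) ?is)"
    unfolding eq by (rule assoc_mult_mat[OF F A select_mat_carrier])
  also have "A * select_mat (length w) ?is = ?D" by (rule mult_select_mat[OF A "is"(1)])
  finally have "gram (mat_of_cols N (nths w I)) = gram F * (det ?D)\<^sup>2"
    using gram_mult[OF F, of ?D] "is"(2) mat_of_cols_carrier(1)[of m "map (col A) ?is"] by simp
  then show ?thesis unfolding wedge_norm_eq by (simp add: real_sqrt_mult)
qed

section \<open>Normalisation of the coefficients and the final identity\<close>

text \<open>The convention for zero respects products, also for \<open>k\<close> equal to 0, because
  a product of reals vanishes exactly when a factor does.\<close>

lemma power0_mult: "power0 (x * y) k = power0 x k * power0 y k"
  by (simp add: power0_def power_mult_distrib)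

lemma power0_divide: "power0 (x / y) k = power0 x k / power0 y k"
  by (simp add: power0_def power_divide)

lemma mconst_mult: "mconst c * mconst d = mconst (c * d)"
  by (simp add: mconst_def mult_single)

text \<open>The covolume of the saturation cancels and only that of the generated lattice remains.
  \<open>f\<close> and \<open>g\<close> stand for the norms and the monomials, which lets
  \<open>Sym\<close> and \<open>Kir\<close> share the computation.\<close>

lemma normalised_wedge_sum:
  assumes w: "set w \<subseteq> carrier_vec N"
    and a: "a = covol N (int_span N w) / covol N (sat_span N w)"
  shows "mconst (1 / power0 a k) * (mconst (1 / power0 (covol N (sat_span N w)) k) *
      (\<Sum>I\<in>\<I>. mconst (power0 (f I) k) * g I))
    = (\<Sum>I\<in>\<I>. mconst (power0 (f I / covol N (int_span N w)) k) * g I)"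
proof -
  let ?c = "covol N (int_span N w)" and ?s = "covol N (sat_span N w)"
  have "a * ?s = ?c" using covol_ratio(2)[OF w] by (simp add: a)
  then have "1 / power0 a k * (1 / power0 ?s k) = 1 / power0 ?c k"
    using power0_mult[of a ?s k] by simp
  then have m: "mconst (1 / power0 a k) * mconst (1 / power0 ?s k) = mconst (1 / power0 ?c k)"
    by (simp add: mconst_mult)
  have "mconst (1 / power0 a k) * (mconst (1 / power0 ?s k) * (\<Sum>I\<in>\<I>. mconst (power0 (f I) k) * g I))
    = mconst (1 / power0 ?c k) * (\<Sum>I\<in>\<I>. mconst (power0 (f I) k) * g I)"
    by (simp only: m mult.assoc[symmetric])
  also have "\<dots> = (\<Sum>I\<in>\<I>. mconst (power0 (f I / ?c) k) * g I)"
    unfolding sum_distrib_left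
    by (intro sum.cong refl) (simp add: mconst_mult power0_divide flip: mult.assoc)
  finally show ?thesis .
qed

theorem theorem2p12:
  fixes p n q r k :: nat
    and u v :: "int vec list"
    and U V :: "int mat"
    and a b :: real
  assumes "p > 0" and "n > 0" and "q > 0"
    and "length u = n" and "set u \<subseteq> carrier_vec p" and "U = mat_of_cols p u"
    and "vec_space.rank p (map_mat real_of_int U) = r"
    and "even k"
    and "length v = n" and "set v \<subseteq> carrier_vec q" and "V = mat_of_cols q v"
    and "LinearCombinations.module.span class_ring (module_vec TYPE(real) n)
           (set (rows (map_mat real_of_int V)))
           = mat_kernel (map_mat real_of_int U)"
    and "a = covol p (int_span p u) / covol p (sat_span p u)"
    and "b = covol q (int_span q v) / covol q (sat_span q v)"
  shows "a = real (quotient_order p (sat_span p u) (int_span p u)) \<and>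
         b = real (quotient_order q (sat_span q v) (int_span q v)) \<and>
         mconst (1 / power0 a k) * Sym p k u = mconst (1 / power0 b k) * Kir q k v"
proof (intro conjI)
  note u = assms(5) and v = assms(10)
  let ?R = "map_mat real_of_int"
  show "a = real (quotient_order p (sat_span p u) (int_span p u))"
    using covol_ratio(3)[OF u] assms(13) by simp
  show "b = real (quotient_order q (sat_span q v) (int_span q v))"
    using covol_ratio(3)[OF v] assms(14) by simp
  have U: "U \<in> carrier_mat p n" and V: "V \<in> carrier_mat q n" using assms by auto
  let ?Vt = "transpose_mat V"
  have Vt: "?Vt \<in> carrier_mat n q" using V by simp
  obtain F A A' r' where F: "F \<in> carrier_mat p r'" "mat_inj F"
    and A: "A \<in> carrier_mat r' n" "A' \<in> carrier_mat n r'" "A * A' = 1\<^sub>m r'"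
    and UF: "U = F * A" "F = U * A'"
    and cu: "covol p (int_span p u) = sqrt (real_of_int (gram F))"
    using int_span_basis[OF u] unfolding assms(4) assms(6)[symmetric] by metis
  obtain G B B' s where G: "G \<in> carrier_mat q s" "mat_inj G"
    and B: "B \<in> carrier_mat s n" "B' \<in> carrier_mat n s" "B * B' = 1\<^sub>m s"
    and VG: "V = G * B" "G = V * B'"
    and cv: "covol q (int_span q v) = sqrt (real_of_int (gram G))"
    using int_span_basis[OF v] unfolding assms(9) assms(11)[symmetric] by metis
  have ru: "family_rank p u = r'"
    by (rule family_rank_eq[OF u F]) (use A UF assms in auto)
  have rv: "family_rank q v = s"
    by (rule family_rank_eq[OF v G]) (use B VG assms in auto)
  have Bt: "transpose_mat B \<in> carrier_mat n s" and Gt: "transpose_mat G \<in> carrier_mat s q"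
    using B G by auto
  have VtG: "?Vt = transpose_mat B * transpose_mat G"
    using VG transpose_mult[OF G(1) B(1)] by simp
  have RU: "?R U \<in> carrier_mat p n" and RVt: "?R ?Vt \<in> carrier_mat n q" using U Vt by auto
  have ker: "mat_range (?R ?Vt) = mat_kernel (?R U)"
  proof -
    interpret idom_vec n "TYPE(real)" .
    have "set (rows (?R V)) \<subseteq> carrier_vec n" using V rows_carrier[of "?R V"] by simp
    moreover have "mat_of_cols n (rows (?R V)) = ?R ?Vt"
      using V by (metis carrier_matD(2) index_map_mat(3) map_mat_transpose mat_of_rows_rows
          transpose_mat_of_rows)
    ultimately show ?thesis using span_eq_mat_range assms(12) by metis
  qed
  have RUV: "?R U * ?R ?Vt = 0\<^sub>m p q"
  proof (rule mat_eq_colI)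
    fix j assume j: "j < q"
    have "col (?R ?Vt) j \<in> mat_kernel (?R U)"
      using col_in_mat_range[OF RVt j] ker by simp
    then have "?R U *\<^sub>v col (?R ?Vt) j = 0\<^sub>v p" using mat_kernelD[OF RU] by blast
    then show "col (?R U * ?R ?Vt) j = col (0\<^sub>m p q) j"
      using col_mult2[OF RU RVt j] j by simp
  qed (use RU RVt in auto)
  have UV: "U * ?Vt = 0\<^sub>m p q"
  proof (rule eq_matI)
    fix i j assume ij: "i < dim_row (0\<^sub>m p q :: int mat)" "j < dim_col (0\<^sub>m p q :: int mat)"
    have "?R (U * ?Vt) $$ (i,j) = 0"
      using of_int_hom.mat_hom_mult[OF U Vt, where 'a = real] RUV ij by simp
    then show "(U * ?Vt) $$ (i,j) = 0\<^sub>m p q $$ (i,j)" using ij U Vt by simp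
  qed (use U Vt in auto)
  \<comment> \<open>U V^T = F (A V^T), and the injective \<open>F\<close> cancels; transposing the
    result then allows \<open>G\<close> to be cancelled in the same way.\<close>
  have AVt: "A * ?Vt = 0\<^sub>m r' q"
    by (rule mat_inj_cancel[OF F(2,1)])
      (use A Vt UV UF(1) assoc_mult_mat[OF F(1) A(1) Vt] F in auto)
  have BAt: "B * transpose_mat A = 0\<^sub>m s r'"
  proof (rule mat_inj_cancel[OF G(2,1)])
    have "G * (B * transpose_mat A) = transpose_mat (A * ?Vt)"
      using assoc_mult_mat[OF G(1) B(1), of "transpose_mat A" r'] A VG(1) transpose_mult[OF A(1) Vt]
      by simp
    then show "G * (B * transpose_mat A) = G * 0\<^sub>m s r'" using AVt G by simp
  qed (use A B in auto)
  have orth: "A * transpose_mat B = 0\<^sub>m r' s"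
    using transpose_mult[OF B(1), of "transpose_mat A" r'] A BAt by (auto intro!: eq_matI)
  have rk: "n = r' + s"
  \<comment> \<open>A real vector killed by \<open>A\<close> is killed by U = F A, hence lies in the
    range of V^T = B^T G^T and so in that of B^T.\<close>
  proof (rule complementary_rank[OF A B orth])
    fix x assume x: "x \<in> carrier_vec n" "?R A *\<^sub>v x = 0\<^sub>v r'"
    have RA: "?R F \<in> carrier_mat p r'" "?R A \<in> carrier_mat r' n" using F A by auto
    have "?R U = ?R F * ?R A"
      using of_int_hom.mat_hom_mult[OF F(1) A(1), where 'a = real] UF(1) by simp
    then have "?R U *\<^sub>v x = 0\<^sub>v p"
      using assoc_mult_mat_vec[OF RA x(1)] x(2) mult_mat_vec_zero[OF RA(1)] by simp
    then have "x \<in> mat_range (?R ?Vt)" unfolding ker using mat_kernelI[OF RU x(1)] by simp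
    moreover have "?R ?Vt = ?R (transpose_mat B) * ?R (transpose_mat G)"
      using of_int_hom.mat_hom_mult[OF Bt Gt, where 'a = real] VtG by simp
    ultimately show "x \<in> mat_range (?R (transpose_mat B))"
      using mat_range_mult_subset[of "?R (transpose_mat B)" n s "?R (transpose_mat G)" q] Bt Gt by auto
  qed
  have coeff: "wedge_norm p (nths u I) / covol p (int_span p u)
      = wedge_norm q (nths v ({..<n} - I)) / covol q (int_span q v)"
    if I: "I \<subseteq> {..<n}" "card I = r'" for I
  proof -
    let ?J = "{..<n} - I"
    have J: "?J \<subseteq> {..<n}" "card ?J = s" using I rk by (auto simp: card_Diff_subset finite_subset)
    have "\<bar>det (mat_of_cols r' (map (col A) (nths [0..<n] I)))\<bar>
        = \<bar>det (mat_of_cols s (map (col B) (nths [0..<n] ?J)))\<bar>"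
      by (rule complementary_minors[OF A B orth rk])
        (use I J in \<open>auto simp: set_nths_upt length_nths_upt distinct_nthsI\<close>)
    then have "\<bar>real_of_int (det (mat_of_cols r' (map (col A) (nths [0..<n] I))))\<bar>
        = \<bar>real_of_int (det (mat_of_cols s (map (col B) (nths [0..<n] ?J))))\<bar>"
      by (metis of_int_abs)
    moreover have "wedge_norm p (nths u I) / covol p (int_span p u)
        = \<bar>real_of_int (det (mat_of_cols r' (map (col A) (nths [0..<n] I))))\<bar>"
      using wedge_norm_nths[OF u F(1), of A I] A UF(1) I assms(4,6) cu covol_ratio(1)[OF u] by simp
    moreover have "wedge_norm q (nths v ?J) / covol q (int_span q v)
        = \<bar>real_of_int (det (mat_of_cols s (map (col B) (nths [0..<n] ?J))))\<bar>"
      using wedge_norm_nths[OF v G(1), of B ?J] B VG(1) J assms(9,11) cv covol_ratio(1)[OF v] by simp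
    ultimately show ?thesis by simp
  qed
  have "mconst (1 / power0 a k) * Sym p k u = (\<Sum>I | I \<subseteq> {..<n} \<and> card I = r'.
      mconst (power0 (wedge_norm p (nths u I) / covol p (int_span p u)) k) * mprod ({..<n} - I))"
    unfolding Sym_def ru assms(4) by (rule normalised_wedge_sum[OF u assms(13)])
  also have "\<dots> = (\<Sum>J | J \<subseteq> {..<n} \<and> card J = s.
      mconst (power0 (wedge_norm q (nths v J) / covol q (int_span q v)) k) * mprod J)"
  \<comment> \<open>Complementation exchanges the subsets of size \<open>r'\<close> and
    \<open>s\<close>, and the monomial of the complement of \<open>I\<close> in \<open>Sym\<close>
    is the monomial of that set in \<open>Kir\<close>.\<close>
  proof (rule sum.reindex_bij_witness[where i = "\<lambda>J. {..<n} - J" and j = "\<lambda>I. {..<n} - I"])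
    fix I assume "I \<in> {I. I \<subseteq> {..<n} \<and> card I = r'}"
    then have I: "I \<subseteq> {..<n}" "card I = r'" by auto
    show "mconst (power0 (wedge_norm q (nths v ({..<n} - I)) / covol q (int_span q v)) k) * mprod ({..<n} - I)
      = mconst (power0 (wedge_norm p (nths u I) / covol p (int_span p u)) k) * mprod ({..<n} - I)"
      using coeff[OF I] by simp
  qed (use rk in \<open>auto simp: card_Diff_subset finite_subset\<close>)
  also have "\<dots> = mconst (1 / power0 b k) * Kir q k v"
    unfolding Kir_def rv assms(9) by (rule normalised_wedge_sum[OF v assms(14), symmetric])
  finally show "mconst (1 / power0 a k) * Sym p k u = mconst (1 / power0 b k) * Kir q k v" .
qed

end
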